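(* Let $L>0$, let $\mathbb T^2=\mathbb R^2/(\mathbb Z\times L\mathbb Z)$ with coordinates $(x,y)$, let $g_{\mathrm{con}}=\mathrm dx^2+\mathrm dy^2$ be the flat metric, and let $b_{\mathrm{con}}>0$ be a constant. Let $$\mathcal B:=\{2\pi n/\xi\ :\ n\in\mathbb N,\ n\ge 1,\ \xi\in(0,\infty),\ J_1(\xi)=0\},$$ where $J_1$ is the Bessel function of the first kind of order one. (i) Assume $b_{\mathrm{con}}\in\mathcal B$. Then there exists a family $s\mapsto b_s$, $s\in(-b_{\mathrm{con}}^{-1},b_{\mathrm{con}}^{-1})$, of magnetic functions $b_s:\mathbb T^2\to(0,\infty)$ depending only on the $x$-variable such that $b_0=b_{\mathrm{con}}$ and, for all $s\in(-b_{\mathrm{con}}^{-1},b_{\mathrm{con}}^{-1})$, $\langle b_s\rangle=b_{\mathrm{con}}$ and the magnetic system $(g_{\mathrm{con}},b_s)$ is Zoll. Moreover the deformation is non-trivial and unbounded: $$\frac{\mathrm d b_s}{\mathrm d s}(0)\neq 0\ \text{ (as a function on } \mathbb T^2),\qquad \lim_{s\to\pm b_{\mathrm{con}}^{-1}}\max b_s=\infty .$$ (ii) If $b_{\mathrm{con}}\notin\mathcal B$, then the only magnetic function $b:\mathbb T^2\to\mathbb R$ depending only on $x$ with $\langle b\rangle=b_{\mathrm{con}}$ such that $(g_{\mathrm{con}},b)$ is Zoll is the constant function $b=b_{\mathrm{con}}$.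
   Context: A magnetic system on a closed oriented surface $\Sigma$ is a pair $(g,b)$ with $g$ a Riemannian metric and $b:\Sigma\to\mathbb R$ a smooth function (the magnetic function). A $(g,b)$-geodesic is a unit-speed curve $\gamma:\mathbb R\to\Sigma$ whose geodesic curvature (with respect to $g$ and the orientation) satisfies $\kappa_\gamma(t)=b(\gamma(t))$, i.e. $\nabla_{\dot\gamma}\dot\gamma=b(\gamma)\,\dot\gamma^\perp$, where $\dot\gamma^\perp$ is $\dot\gamma$ rotated by $+\pi/2$. The flow $\Phi^t_{g,b}$ on the unit tangent bundle $\mathrm S\Sigma$ is $\Phi_{g,b}^t(q,v)=(\gamma(t),\dot\gamma(t))$, where $\gamma$ is the $(g,b)$-geodesic with $(\gamma(0),\dot\gamma(0))=(q,v)$. The average of $b$ is $\langle b\rangle=\frac{1}{\mathrm{area}(\Sigma,g)}\int_\Sigma b\,\mu_g$, where $\mu_g$ is the Riemannian area form. The torus $\mathbb T^2$ is oriented by $\mathrm dx\wedge\mathrm dy$. The system $(g,b)$ is called Zoll if $\Phi^t_{g,b}$ yields (up to time reparametrization of the orbits) a free $S^1$-action on $\mathrm S\Sigma$, i.e. the oriented flow orbits are exactly the oriented orbits of a smooth free $S^1$-action on $\mathrm S\Sigma$. (The orbits are not required to have the same period for the unit-speed parametrization.) *)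

theory Defs
  imports "HOL-Analysis.Analysis"
begin

text \<open>
  The plane is the type \<^typ>\<open>complex\<close>, with \<open>z = x + \<i> y\<close>. The orientation is \<open>dx \<and> dy\<close>, so rotation by
  \<open>+\<pi>/2\<close> is multiplication by \<open>\<i>\<close>, and the flat metric \<open>dx\<^sup>2 + dy\<^sup>2\<close> is the Euclidean one.
\<close>

section \<open>Smoothness\<close>

primrec Ck_on :: "nat \<Rightarrow> 'a::real_normed_vector set \<Rightarrow> ('a \<Rightarrow> 'b::real_normed_vector) \<Rightarrow> bool" where
  "Ck_on 0 S f \<longleftrightarrow> continuous_on S f"
| "Ck_on (Suc k) S f \<longleftrightarrow> (\<forall>x\<in>S. f differentiable (at x)) \<and>
     (\<forall>v. Ck_on k S (\<lambda>x. frechet_derivative f (at x) v))"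

text \<open>
  In finite dimensions and for open \<open>S\<close> this is the usual notion of \<open>C\<^sup>\<infinity>\<close>: all iterated directional
  derivatives exist and are continuous. It is only used in that situation.
\<close>
definition smooth_on :: "'a::real_normed_vector set \<Rightarrow> ('a \<Rightarrow> 'b::real_normed_vector) \<Rightarrow> bool" where
  "smooth_on S f \<longleftrightarrow> (\<forall>k. Ck_on k S f)"


section \<open>The torus \<open>\<real>\<^sup>2 / (\<int> \<times> L\<int>)\<close> and its unit tangent bundle\<close>

text \<open>Points of the torus are cosets.\<close>
definition torus_proj :: "real \<Rightarrow> complex \<Rightarrow> complex set" where
  "torus_proj L z = {z + Complex (of_int m) (L * of_int n) | m n :: int. True}"

definition torus :: "real \<Rightarrow> complex set set" where
  "torus L = range (torus_proj L)"

text \<open>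
  The tangent bundle of the torus is trivialised by the coordinate frame, so a unit tangent vector
  is a pair of a point of the torus and a unit vector of the plane.
\<close>
definition unit_tangent_bundle :: "real \<Rightarrow> (complex set \<times> complex) set" where
  "unit_tangent_bundle L = torus L \<times> sphere 0 1"

text \<open>
  Smoothness of a map into the torus with respect to the quotient manifold structure: local smooth
  lifts to the plane exist.
\<close>
definition smooth_to_torus :: "real \<Rightarrow> ('a::real_normed_vector \<Rightarrow> complex set) \<Rightarrow> bool" where
  "smooth_to_torus L f \<longleftrightarrow>
     (\<forall>w. \<exists>U F. open U \<and> w \<in> U \<and> smooth_on U F \<and> (\<forall>u\<in>U. f u = torus_proj L (F u)))"


section \<open>Magnetic functions\<close>

text \<open>
  A function on the torus is a function on cosets; its values outside \<open>torus L\<close> are irrelevant.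
\<close>
definition magnetic_function :: "real \<Rightarrow> (complex set \<Rightarrow> real) \<Rightarrow> bool" where
  "magnetic_function L b \<longleftrightarrow> smooth_on UNIV (\<lambda>z. b (torus_proj L z))"

definition depends_only_on_x :: "real \<Rightarrow> (complex set \<Rightarrow> real) \<Rightarrow> bool" where
  "depends_only_on_x L b \<longleftrightarrow>
     (\<forall>z w. Re z = Re w \<longrightarrow> b (torus_proj L z) = b (torus_proj L w))"

text \<open>Integral against the flat area form, over the fundamental domain \<open>[0,1] \<times> [0,L]\<close>.\<close>
definition torus_integral :: "real \<Rightarrow> (complex set \<Rightarrow> real) \<Rightarrow> real" where
  "torus_integral L f = integral (cbox 0 (Complex 1 L)) (\<lambda>z. f (torus_proj L z))"

definition torus_average :: "real \<Rightarrow> (complex set \<Rightarrow> real) \<Rightarrow> real" where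
  "torus_average L b = torus_integral L b / torus_integral L (\<lambda>_. 1)"


section \<open>Magnetic geodesics and their flow for the flat metric\<close>

text \<open>
  \<open>c\<close> is a lift to the plane of the curve \<open>\<gamma> = torus_proj L \<circ> c\<close>, and \<open>v\<close> is the velocity of \<open>\<gamma>\<close> in the
  coordinate frame, which does not depend on the lift. As the metric is flat, the covariant
  derivative of \<open>v\<close> is its ordinary derivative, and \<open>\<i> * v t\<close> is \<open>v t\<close> rotated by \<open>+\<pi>/2\<close>.
\<close>
definition magnetic_geodesic ::
    "real \<Rightarrow> (complex set \<Rightarrow> real) \<Rightarrow> (real \<Rightarrow> complex) \<Rightarrow> (real \<Rightarrow> complex) \<Rightarrow> bool" where
  "magnetic_geodesic L b c v \<longleftrightarrow> (\<forall>t.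
     (c has_vector_derivative v t) (at t) \<and> norm (v t) = 1 \<and>
     (v has_vector_derivative of_real (b (torus_proj L (c t))) * (\<i> * v t)) (at t))"

definition magnetic_flow ::
    "real \<Rightarrow> (complex set \<Rightarrow> real) \<Rightarrow> real \<Rightarrow> complex set \<times> complex \<Rightarrow> complex set \<times> complex" where
  "magnetic_flow L b t p = (THE q. \<exists>c v. magnetic_geodesic L b c v \<and>
     (torus_proj L (c 0), v 0) = p \<and> (torus_proj L (c t), v t) = q)"


section \<open>Zoll systems\<close>

text \<open>
  The circle is \<open>sphere 0 1\<close> in \<^typ>\<open>complex\<close>. The action map is smooth iff it is smooth after composition
  with the surjective local diffeomorphism \<open>(\<theta>, z, \<phi>) \<mapsto> (cis \<theta>, (torus_proj L z, cis \<phi>))\<close> onto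
  \<open>S\<^sup>1 \<times> ST\<^sup>2\<close>.
\<close>
definition smooth_free_circle_action ::
    "real \<Rightarrow> (complex \<Rightarrow> complex set \<times> complex \<Rightarrow> complex set \<times> complex) \<Rightarrow> bool" where
  "smooth_free_circle_action L A \<longleftrightarrow>
     (\<forall>u\<in>sphere 0 1. \<forall>p\<in>unit_tangent_bundle L. A u p \<in> unit_tangent_bundle L) \<and>
     (\<forall>p\<in>unit_tangent_bundle L. A 1 p = p) \<and>
     (\<forall>u\<in>sphere 0 1. \<forall>w\<in>sphere 0 1. \<forall>p\<in>unit_tangent_bundle L. A (u * w) p = A u (A w p)) \<and>
     (\<forall>u\<in>sphere 0 1. \<forall>p\<in>unit_tangent_bundle L. A u p = p \<longrightarrow> u = 1) \<and>
     smooth_to_torus L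
       (\<lambda>(\<theta>::real, z::complex, \<phi>::real). fst (A (cis \<theta>) (torus_proj L z, cis \<phi>))) \<and>
     smooth_on UNIV
       (\<lambda>(\<theta>::real, z::complex, \<phi>::real). snd (A (cis \<theta>) (torus_proj L z, cis \<phi>)))"

text \<open>
  The orbit of the action and the flow orbit through \<open>p\<close> agree as oriented curves: they differ by an
  increasing bijection \<open>h\<close> of the time parameter, which may depend on \<open>p\<close>. (An increasing surjection
  of the reals is automatically a homeomorphism.)
\<close>
definition zoll :: "real \<Rightarrow> (complex set \<Rightarrow> real) \<Rightarrow> bool" where
  "zoll L b \<longleftrightarrow> (\<exists>A. smooth_free_circle_action L A \<and>
     (\<forall>p\<in>unit_tangent_bundle L. \<exists>h::real \<Rightarrow> real. strict_mono h \<and> surj h \<and> h 0 = 0 \<and>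
        (\<forall>\<tau>. A (cis \<tau>) p = magnetic_flow L b (h \<tau>) p)))"


section \<open>Bessel functions and the resonant set\<close>

definition bessel_J :: "nat \<Rightarrow> real \<Rightarrow> real" where
  "bessel_J n x = (\<Sum>m. (-1) ^ m / (fact m * fact (m + n)) * (x / 2) ^ (2 * m + n))"

definition resonant_set :: "real set" where
  "resonant_set = {2 * pi * real n / \<xi> | n \<xi>. n \<ge> 1 \<and> \<xi> > 0 \<and> bessel_J 1 \<xi> = 0}"

end

theory Submission
  imports Defs
begin

text \<open>
  Write \<open>b = \<beta>(x)\<close>, let \<open>B\<close> be a primitive of \<open>\<beta>\<close> and \<open>\<phi>\<close> the angle of the velocity. Then \<open>sin \<phi> - B(x)\<close> is
  constant along geodesics. If \<open>\<beta> > 0\<close> and \<open>X\<close> is the inverse of \<open>B\<close>, the geodesic of energy \<open>K\<close> is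
  \<open>x = X(K + sin \<phi>)\<close>, \<open>dy/d\<phi> = sin \<phi> X'(K + sin \<phi>)\<close>, \<open>dt/d\<phi> = X'(K + sin \<phi>)\<close>, so the system is Zoll as
  soon as the displacement \<open>\<Delta>(K) = \<integral> sin \<phi> X'(K + sin \<phi>) d\<phi>\<close> over a turn vanishes for all \<open>K\<close>; the circle
  then acts by \<open>\<phi> \<mapsto> \<phi> + \<theta>\<close>. For \<open>X\<^sub>s(u) = u / b\<^sub>c\<^sub>o\<^sub>n + (s / k) sin (k u)\<close> this displacement is a
  multiple of \<open>s J\<^sub>1(k)\<close>, which gives (i).

  Conversely, in a Zoll system \<open>\<beta>\<close> has no zero, because a vertical line over a zero is approached by
  geodesics that never close up. Closedness then puts \<open>\<Delta>(K)\<close> into \<open>L \<rat>\<close>, so \<open>\<Delta>\<close> is constant. Its Fourier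
  coefficients are those of \<open>X'\<close> times values of \<open>J\<^sub>1\<close> that do not vanish in the nonresonant case, so
  \<open>X'\<close> is constant.
\<close>

section \<open>Calculus of smooth functions\<close>

text \<open>Passing to the inverse \<open>X\<close> of \<open>B\<close> linearises the problem: the
  Zoll condition is nonlinear in \<beta>, but the displacement \<Delta>(K) is linear in
  \<open>X'\<close> and commutes with translations of K. It is therefore diagonal on Fourier modes,
  with a factor proportional to J_1(k) at frequency k. Since \<open>B (x + 1) = B x + bcon\<close>,
  the average of \<beta> is the period of \<open>X'\<close>; the admissible frequencies are 2 pi n /
  bcon, and one of them is a zero of J_1 exactly when \<open>bcon\<close> lies in
  \<open>resonant_set\<close>. For the deformation, 1/bcon + s cos(k u) is positive for all u
  precisely if |s| < 1/bcon, and the maximum of its inverse, 1/(1/bcon - |s|), blows up at both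
  ends.

  In the converse a closed orbit may make m turns and climb by a multiple of L, so it only shows
  that m \<Delta>(K) lies in L Z, with m depending on K. Continuity in K turns this into constancy.
  The constant is not known to vanish at this point, but it has no mode besides the mean, and the
  mean of \<open>X'\<close> is known.\<close>

lemma Ck_on_SucI:
  assumes "\<And>x. (f has_derivative D x) (at x)" and "\<And>v. Ck_on k UNIV (\<lambda>x. D x v)"
  shows "Ck_on (Suc k) UNIV f"
proof -
  have "frechet_derivative f (at x) = D x" for x
    using frechet_derivative_at[OF assms(1)] by metis
  then show ?thesis
    using assms by (auto simp: differentiable_def)
qed

lemma Ck_on_Suc_has_derivative:
  assumes "Ck_on (Suc k) UNIV f"
  shows "(f has_derivative frechet_derivative f (at x)) (at x)"
  using assms by (simp add: frechet_derivative_works)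

lemma Ck_on_SucD: "Ck_on (Suc k) UNIV f \<Longrightarrow> Ck_on k UNIV f"
proof (induction k arbitrary: f)
  case 0
  then show ?case
    by (auto simp: continuous_on_eq_continuous_at intro: differentiable_imp_continuous_within)
next
  case (Suc k)
  have "\<forall>v. Ck_on (Suc k) UNIV (\<lambda>x. frechet_derivative f (at x) v)"
    and "\<forall>x\<in>UNIV. f differentiable at x"
    using Ck_on.simps(2)[THEN iffD1, OF Suc.prems] by blast+
  then show ?case
    using Suc.IH by (subst Ck_on.simps(2)) blast
qed

lemma Ck_on_const: "Ck_on k UNIV (\<lambda>x. c)"
proof (induction k arbitrary: c)
  case (Suc k)
  show ?case
    by (rule Ck_on_SucI[where D = "\<lambda>x v. 0"]) (auto intro: Suc)
qed simp

lemma Ck_on_bounded_linear: 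
  assumes "bounded_linear f"
  shows "Ck_on k UNIV f"
proof (cases k)
  case 0
  then show ?thesis
    using assms by (simp add: linear_continuous_on)
next
  case (Suc n)
  show ?thesis
    unfolding Suc
    by (rule Ck_on_SucI[where D = "\<lambda>x. f"])
       (auto intro: Ck_on_const bounded_linear_imp_has_derivative assms)
qed

lemma Ck_on_add:
  assumes "Ck_on k UNIV f" "Ck_on k UNIV g"
  shows "Ck_on k UNIV (\<lambda>x. f x + g x)"
  using assms
proof (induction k arbitrary: f g)
  case (Suc k)
  show ?case
    by (rule Ck_on_SucI[where D = "\<lambda>x v. frechet_derivative f (at x) v + frechet_derivative g (at x) v"])
       (use Suc in \<open>auto intro!: derivative_intros Ck_on_Suc_has_derivative Suc.IH\<close>)
qed (auto intro: continuous_intros)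

lemma Ck_on_linear_compose:
  assumes "bounded_linear l" "Ck_on k UNIV f"
  shows "Ck_on k UNIV (\<lambda>x. l (f x))"
  using assms(2)
proof (induction k arbitrary: f)
  case 0
  then show ?case
    using assms(1) by (auto intro: bounded_linear.continuous_on)
next
  case (Suc k)
  show ?case
    by (rule Ck_on_SucI[where D = "\<lambda>x v. l (frechet_derivative f (at x) v)"])
       (use Suc in \<open>auto intro!: bounded_linear.has_derivative[OF assms(1)] Ck_on_Suc_has_derivative Suc.IH\<close>)
qed

lemma Ck_on_mult:
  fixes f g :: "'a::real_normed_vector \<Rightarrow> real"
  assumes "Ck_on k UNIV f" "Ck_on k UNIV g"
  shows "Ck_on k UNIV (\<lambda>x. f x * g x)"
  using assms
proof (induction k arbitrary: f g)
  case (Suc k)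
  show ?case
  proof (rule Ck_on_SucI[where D = "\<lambda>x v. f x * frechet_derivative g (at x) v + frechet_derivative f (at x) v * g x"])
    show "((\<lambda>x. f x * g x) has_derivative
        (\<lambda>v. f x * frechet_derivative g (at x) v + frechet_derivative f (at x) v * g x)) (at x)" for x
      by (intro has_derivative_mult Ck_on_Suc_has_derivative[OF Suc.prems(1)] Ck_on_Suc_has_derivative[OF Suc.prems(2)])
    show "Ck_on k UNIV (\<lambda>x. f x * frechet_derivative g (at x) v + frechet_derivative f (at x) v * g x)" for v
      using Suc.prems Ck_on_SucD[OF Suc.prems(1)] Ck_on_SucD[OF Suc.prems(2)] 
      by (intro Ck_on_add Suc.IH) auto
  qed
qed (auto intro: continuous_intros)

text \<open>A scalar outer function makes the chain rule a product of scalars, so the induction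
  reduces to \<open>Ck_on_mult\<close>, with \<open>g\<close> replaced by its derivative.\<close>

lemma Ck_on_real_compose:
  fixes g :: "real \<Rightarrow> real" and f :: "'a::real_normed_vector \<Rightarrow> real"
  assumes "Ck_on k UNIV g" "Ck_on k UNIV f"
  shows "Ck_on k UNIV (\<lambda>x. g (f x))"
  using assms
proof (induction k arbitrary: f g)
  case 0
  then show ?case
    by (auto intro: continuous_on_compose2)
next
  case (Suc k)
  show ?case
  proof (rule Ck_on_SucI[where D = "\<lambda>x v. frechet_derivative g (at (f x)) 1 * frechet_derivative f (at x) v"])
    show "((\<lambda>x. g (f x)) has_derivative
        (\<lambda>v. frechet_derivative g (at (f x)) 1 * frechet_derivative f (at x) v)) (at x)" for x
    proof -
      have g: "(g has_derivative frechet_derivative g (at (f x))) (at (f x))"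
        by (rule Ck_on_Suc_has_derivative[OF Suc.prems(1)])
      have lin: "frechet_derivative g (at (f x)) w = frechet_derivative g (at (f x)) 1 * w" for w
        using linear_cmul[OF has_derivative_linear[OF g], of w 1] by simp
      show ?thesis
        using has_derivative_compose[OF Ck_on_Suc_has_derivative[OF Suc.prems(2)] g]
        by (subst (asm) lin) 
    qed
    show "Ck_on k UNIV (\<lambda>x. frechet_derivative g (at (f x)) 1 * frechet_derivative f (at x) v)" for v
      using Suc.prems Ck_on_SucD[OF Suc.prems(2)]
      by (intro Ck_on_mult Suc.IH[where g = "\<lambda>u. frechet_derivative g (at u) 1"]) auto
  qed
qed

lemma Ck_on_Suc_real:
  fixes f :: "real \<Rightarrow> real"
  assumes "\<And>x. (f has_real_derivative f' x) (at x)" "Ck_on k UNIV f'"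
  shows "Ck_on (Suc k) UNIV f"
  by (rule Ck_on_SucI[where D = "\<lambda>x v. f' x * v"])
     (use assms in \<open>auto simp: has_field_derivative_def intro: Ck_on_mult Ck_on_const\<close>)

lemma smooth_on_const: "smooth_on UNIV (\<lambda>x. c)"
  by (simp add: smooth_on_def Ck_on_const)

lemma smooth_on_bounded_linear: "bounded_linear f \<Longrightarrow> smooth_on UNIV f"
  by (simp add: smooth_on_def Ck_on_bounded_linear)

lemma smooth_on_add: "smooth_on UNIV f \<Longrightarrow> smooth_on UNIV g \<Longrightarrow> smooth_on UNIV (\<lambda>x. f x + g x)"
  by (simp add: smooth_on_def Ck_on_add)

lemma smooth_on_linear_compose:
  "bounded_linear l \<Longrightarrow> smooth_on UNIV f \<Longrightarrow> smooth_on UNIV (\<lambda>x. l (f x))"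
  by (simp add: smooth_on_def Ck_on_linear_compose)

lemma smooth_on_mult:
  fixes f g :: "'a::real_normed_vector \<Rightarrow> real"
  shows "smooth_on UNIV f \<Longrightarrow> smooth_on UNIV g \<Longrightarrow> smooth_on UNIV (\<lambda>x. f x * g x)"
  by (simp add: smooth_on_def Ck_on_mult)

lemma smooth_on_diff:
  assumes "smooth_on UNIV f" "smooth_on UNIV g"
  shows "smooth_on UNIV (\<lambda>x. f x - g x)"
  using smooth_on_add[OF assms(1) smooth_on_linear_compose[OF bounded_linear_minus[OF bounded_linear_ident] assms(2)]]
  by simp

lemma smooth_on_real_compose:
  fixes g :: "real \<Rightarrow> real" and f :: "'a::real_normed_vector \<Rightarrow> real"
  shows "smooth_on UNIV g \<Longrightarrow> smooth_on UNIV f \<Longrightarrow> smooth_on UNIV (\<lambda>x. g (f x))"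
  by (simp add: smooth_on_def Ck_on_real_compose)

lemma smooth_on_real_primitive:
  fixes f :: "real \<Rightarrow> real"
  assumes "\<And>x. (f has_real_derivative f' x) (at x)" "smooth_on UNIV f'"
  shows "smooth_on UNIV f"
  using assms Ck_on_SucD Ck_on_Suc_real unfolding smooth_on_def by metis

text \<open>Bootstrapping: if \<open>f\<close> is C^k, then so is its derivative
  \<open>F (f x)\<close>, hence \<open>f\<close> is C^(k+1). This yields smoothness of
  \<open>B\<close>, which as the inverse of \<open>X\<close> solves such an equation.\<close>

lemma smooth_on_autonomous:
  fixes f F :: "real \<Rightarrow> real"
  assumes "\<And>x. (f has_real_derivative F (f x)) (at x)" "smooth_on UNIV F"
  shows "smooth_on UNIV f"
proof -
  have "Ck_on k UNIV f" for k
  proof (induction k)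
    case 0
    show ?case
      using assms(1) by (auto simp: continuous_on_eq_continuous_at intro: DERIV_isCont)
  next
    case (Suc k)
    then show ?case
      using assms(2) Ck_on_Suc_real[OF assms(1)] Ck_on_real_compose[OF _ Suc]
      unfolding smooth_on_def by blast
  qed
  then show ?thesis
    by (simp add: smooth_on_def)
qed

lemma smooth_on_sin: "smooth_on UNIV (sin :: real \<Rightarrow> real)"
  and smooth_on_cos: "smooth_on UNIV (cos :: real \<Rightarrow> real)"
proof -
  have "Ck_on k UNIV (sin :: real \<Rightarrow> real) \<and> Ck_on k UNIV (cos :: real \<Rightarrow> real)" for k
  proof (induction k)
    case (Suc k)
    have "Ck_on k UNIV (\<lambda>x::real. - sin x)"
      using Suc Ck_on_linear_compose[OF bounded_linear_minus[OF bounded_linear_ident]] by blast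
    then show ?case
      using Suc Ck_on_Suc_real[of sin cos] Ck_on_Suc_real[of cos "\<lambda>x. - sin x"]
      by (auto intro: DERIV_sin DERIV_cos)
  qed (auto intro: continuous_intros)
  then show "smooth_on UNIV (sin :: real \<Rightarrow> real)" "smooth_on UNIV (cos :: real \<Rightarrow> real)"
    by (auto simp: smooth_on_def)
qed

lemma smooth_on_inverse:
  fixes f :: "'a::real_normed_vector \<Rightarrow> real"
  assumes "smooth_on UNIV f" "\<And>x. f x \<noteq> 0"
  shows "smooth_on UNIV (\<lambda>x. inverse (f x))"
proof -
  have "Ck_on k UNIV (\<lambda>x. inverse (f x))" for k
  proof (induction k)
    case 0
    have "Ck_on 0 UNIV f"
      using assms(1) unfolding smooth_on_def by blast
    then show ?case
      using assms(2) by (auto intro: continuous_intros)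
  next
    case (Suc k)
    have f: "Ck_on (Suc k) UNIV f"
      using assms(1) by (simp add: smooth_on_def del: Ck_on.simps)
    have "((\<lambda>x. inverse (f x)) has_derivative
        (\<lambda>v. - (inverse (f x) * frechet_derivative f (at x) v * inverse (f x)))) (at x)" for x
      by (rule Deriv.has_derivative_inverse[OF assms(2) Ck_on_Suc_has_derivative[OF f]])
    moreover have "Ck_on k UNIV
        (\<lambda>x. - (inverse (f x) * frechet_derivative f (at x) v * inverse (f x)))" for v
      using f by (intro Ck_on_linear_compose[OF bounded_linear_minus[OF bounded_linear_ident]] Ck_on_mult Suc) auto
    ultimately show ?case
      by (rule Ck_on_SucI)
  qed
  then show ?thesis
    by (simp add: smooth_on_def)
qed

lemma smooth_on_Complex:
  assumes "smooth_on UNIV f" "smooth_on UNIV g"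
  shows "smooth_on UNIV (\<lambda>x. Complex (f x) (g x))"
proof -
  have "smooth_on UNIV (\<lambda>x. complex_of_real (f x) + \<i> * complex_of_real (g x))"
    by (intro smooth_on_add smooth_on_linear_compose[OF _ assms(1)] smooth_on_linear_compose[OF _ assms(2)])
       (auto intro: bounded_linear_of_real bounded_linear_compose[OF bounded_linear_mult_right])
  then show ?thesis
    by (simp add: Complex_eq)
qed

section \<open>Primitives, quasi-periodic functions and uniqueness for the magnetic equation\<close>

lemma real_primitive:
  fixes f :: "real \<Rightarrow> real"
  assumes "continuous_on UNIV f"
  obtains F where "F 0 = 0" "\<And>x. (F has_real_derivative f x) (at x)"
proof -
  define F where "F x = (if 0 \<le> x then integral {0..x} f else - integral {x..0} f)" for x
  have int: "f integrable_on {a..b}" for a b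
    using assms continuous_on_subset integrable_continuous_real by blast
  have "(F has_real_derivative f x) (at x)" for x
  proof -
    \<comment> \<open>Around \<open>x\<close> the signed integral \<open>F\<close> differs by a
      constant from an integral with left end \<open>-n\<close>, to which the fundamental theorem
      applies; so the case distinction at 0 leaves no corner.\<close>
    define n where "n = \<bar>x\<bar> + 1"
    have "x \<in> {-n<..<n}"
      by (auto simp: n_def)
    then have "x \<in> {-n..n}"
      by simp
    have F: "integral {-n..y} f - integral {-n..0} f = F y" if "y \<in> {-n<..<n}" for y
      using Henstock_Kurzweil_Integration.integral_combine[of "-n" 0 y f]
        Henstock_Kurzweil_Integration.integral_combine[of "-n" y 0 f] that int
      by (auto simp: F_def)
    have "((\<lambda>y. integral {-n..y} f - integral {-n..0} f) has_real_derivative f x) (at x within {-n..n})"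
      using DERIV_diff[OF integral_has_real_derivative[of "-n" n f x] DERIV_const]
        continuous_on_subset[OF assms] \<open>x \<in> {-n..n}\<close> by simp
    then have "((\<lambda>y. integral {-n..y} f - integral {-n..0} f) has_real_derivative f x) (at x)"
      using at_within_interior[of x "{-n..n}"] \<open>x \<in> {-n<..<n}\<close> by simp
    then show ?thesis
      by (rule has_field_derivative_transform_within_open[where S = "{-n<..<n}"])
         (use F \<open>x \<in> {-n<..<n}\<close> in auto)
  qed
  then show thesis
    by (intro that[of F]) (simp_all add: F_def)
qed

lemma has_integral_of_primitive:
  fixes F :: "real \<Rightarrow> real"
  assumes "\<And>x. (F has_real_derivative f x) (at x)" "a \<le> b"
  shows "(f has_integral F b - F a) {a..b}"
proof (rule fundamental_theorem_of_calculus[OF assms(2)])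
  show "(F has_vector_derivative f x) (at x within {a..b})" for x
    using has_field_derivative_at_within[OF assms(1)]
    by (simp add: has_real_derivative_iff_has_vector_derivative)
qed

lemma primitive_of_periodic:
  fixes F f :: "real \<Rightarrow> real"
  assumes "\<And>x. (F has_real_derivative f x) (at x)" "\<And>x. f (x + p) = f x"
  shows "F (x + p) = F x + (F p - F 0)"
proof -
  have "((\<lambda>x. F (x + p) - F x) has_real_derivative 0) (at x)" for x
    using DERIV_shift[THEN iffD1, OF assms(1)[of "x + p"]] assms(1)[of x] assms(2)[of x]
    by (auto intro!: derivative_eq_intros)
  then have "F (x + p) - F x = F (0 + p) - F 0"
    using DERIV_isconst_all[of "\<lambda>x. F (x + p) - F x"] by blast
  then show ?thesis
    by simp
qed

lemma quasiperiodic_nat: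
  fixes f :: "real \<Rightarrow> real"
  assumes "\<And>x. f (x + p) = f x + q"
  shows "f (x + real n * p) = f x + real n * q"
proof (induction n)
  case (Suc n)
  then show ?case
    using assms[of "x + real n * p"] by (simp add: algebra_simps)
qed simp

text \<open>Used with \<open>q = 0\<close> for periodic functions, and with general \<open>q\<close>
  for \<open>B\<close>, \<open>X\<close> and the height \<open>Y\<close>, whose increments over a
  period are constant.\<close>

lemma quasiperiodic_int:
  fixes f :: "real \<Rightarrow> real"
  assumes "\<And>x. f (x + p) = f x + q"
  shows "f (x + of_int n * p) = f x + of_int n * q"
proof (cases "n \<ge> 0")
  case True
  then show ?thesis
    using quasiperiodic_nat[of f p q, OF assms, of x "nat n"] by simp
next
  case False
  then show ?thesis
    using quasiperiodic_nat[of f p q, OF assms, of "x + of_int n * p" "nat (- n)"] by (simp add: algebra_simps)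
qed

text \<open>A strictly increasing function that gains a fixed amount over each period is unbounded
  on both sides, hence onto by the intermediate value theorem. This inverts \<open>B\<close>, the
  functions \<open>X s\<close>, and the time along an orbit as a function of the angle.\<close>

lemma quasiperiodic_inverse:
  fixes f f' :: "real \<Rightarrow> real"
  assumes der: "\<And>x. (f has_real_derivative f' x) (at x)" and pos: "\<And>x. f' x > 0"
    and per: "\<And>x. f (x + p) = f x + q" and "p > 0"
  obtains g where "\<And>x. g (f x) = x" "\<And>y. f (g y) = y"
    "\<And>y. (g has_real_derivative inverse (f' (g y))) (at y)" "\<And>y. g (y + q) = g y + p"
proof -
  have mono: "f x < f y" if "x < y" for x y
    using DERIV_pos_imp_increasing[OF that] der pos by blast
  have inj: "f x = f y \<longleftrightarrow> x = y" for x y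
    using mono[of x y] mono[of y x] by (cases x y rule: linorder_cases) auto
  have "q > 0"
    using mono[of 0 p] per[of 0] \<open>p > 0\<close> by simp
  have cont: "isCont f x" for x
    using der DERIV_isCont by blast
  have surj: "\<exists>x. f x = y" for y
  proof -
    define n where "n = \<lceil>(y - f 0) / q\<rceil>"
    have "(y - f 0) / q \<le> of_int n" "of_int n - 1 \<le> (y - f 0) / q"
      unfolding n_def by linarith+
    then have "f 0 + of_int (n - 1) * q \<le> y" "y \<le> f 0 + of_int n * q"
      using \<open>q > 0\<close> by (simp_all add: field_simps)
    then have "f (of_int (n - 1) * p) \<le> y" "y \<le> f (of_int n * p)"
      using quasiperiodic_int[of f p q, OF per, of 0 n] quasiperiodic_int[of f p q, OF per, of 0 "n - 1"]
      by simp_all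
    moreover have "of_int (n - 1) * p \<le> of_int n * p"
      using \<open>p > 0\<close> by (intro mult_right_mono) auto
    ultimately show ?thesis
      using IVT[of f "of_int (n - 1) * p" y "of_int n * p"] cont by auto
  qed
  define g where "g = inv f"
  have gf: "g (f x) = x" for x
    using inj by (simp add: g_def inj_def)
  have fg: "f (g y) = y" for y
  proof -
    obtain x where "f x = y"
      using surj by blast
    then show ?thesis
      using gf by metis
  qed
  have contg: "isCont g y" for y
    using isCont_inverse_function[of 1 "g y" g f] gf cont fg by simp
  show thesis
  proof (rule that[OF gf fg])
    show "(g has_real_derivative inverse (f' (g y))) (at y)" for y
      using pos[of "g y"] fg contg
      by (intro DERIV_inverse_function[where f = f and a = "y - 1" and b = "y + 1"] der) auto
    show "g (y + q) = g y + p" for y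
      using per[of "g y"] fg gf by metis
  qed
qed

lemma periodic_continuous_bounded:
  fixes f :: "real \<Rightarrow> real"
  assumes "continuous_on UNIV f" "\<And>x. f (x + 1) = f x"
  obtains M where "\<And>x. \<bar>f x\<bar> \<le> M"
proof -
  have "compact (f ` {0..1})"
    using assms(1) continuous_on_subset by (intro compact_continuous_image) auto
  then obtain M where M: "\<And>y. y \<in> f ` {0..1} \<Longrightarrow> norm y \<le> M"
    using compact_imp_bounded bounded_iff by metis
  have "\<bar>f x\<bar> \<le> M" for x
  proof -
    have "f x = f (frac x)"
      using quasiperiodic_int[of f 1 0 "frac x" "\<lfloor>x\<rfloor>"] assms(2) by (simp add: frac_def)
    then show ?thesis
      using M[of "f (frac x)"] frac_lt_1[of x] frac_ge_0[of x] by force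
  qed
  then show thesis
    by (rule that)
qed

section \<open>Gronwall's inequality and uniqueness for the magnetic equation\<close>

lemma gronwall_zero:
  fixes E :: "real \<Rightarrow> real"
  assumes der: "\<And>t. (E has_real_derivative E' t) (at t)" and bound: "\<And>t. \<bar>E' t\<bar> \<le> C * E t"
    and "E 0 = 0" "\<And>t. E t \<ge> 0"
  shows "E t = 0"
proof (cases "t \<ge> 0")
  case True
  have "E t * exp (- C * t) \<le> E 0 * exp (- C * 0)"
  proof (rule DERIV_nonpos_imp_nonincreasing[OF True])
    fix x
    have "((\<lambda>t. E t * exp (- C * t)) has_real_derivative (E' x - C * E x) * exp (- C * x)) (at x)"
      using der[of x] by (auto intro!: derivative_eq_intros simp: algebra_simps)
    moreover have "(E' x - C * E x) * exp (- C * x) \<le> 0"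
      using bound[of x] by (intro mult_nonpos_nonneg) auto
    ultimately show "\<exists>y. ((\<lambda>t. E t * exp (- C * t)) has_real_derivative y) (at x) \<and> y \<le> 0"
      by blast
  qed
  then show ?thesis
    using assms(3) assms(4)[of t] by (simp add: mult_le_0_iff)
next
  case False
  \<comment> \<open>For negative times the opposite integrating factor is the monotone one;
    uniqueness is used in both time directions.\<close>
  have "E t * exp (C * t) \<le> E 0 * exp (C * 0)"
  proof (rule DERIV_nonneg_imp_nondecreasing[where f = "\<lambda>t. E t * exp (C * t)"])
    fix x
    have "((\<lambda>t. E t * exp (C * t)) has_real_derivative (E' x + C * E x) * exp (C * x)) (at x)"
      using der[of x] by (auto intro!: derivative_eq_intros simp: algebra_simps)
    moreover have "(E' x + C * E x) * exp (C * x) \<ge> 0"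
      using bound[of x] by (intro mult_nonneg_nonneg) auto
    ultimately show "\<exists>y. ((\<lambda>t. E t * exp (C * t)) has_real_derivative y) (at x) \<and> y \<ge> 0"
      by blast
  qed (use False in simp)
  then show ?thesis
    using assms(3) assms(4)[of t] by (simp add: mult_le_0_iff)
qed

text \<open>Gronwall for the squared distance in phase space. The term that rotates the velocity
  difference \<open>V\<close> is orthogonal to \<open>V\<close>, so only the Lipschitz bound on
  \<beta>, times the unit speed of the second curve, enters the estimate.\<close>

lemma magnetic_ode_unique:
  fixes \<beta> :: "real \<Rightarrow> real" and c1 c2 v1 v2 :: "real \<Rightarrow> complex"
  assumes lip: "\<And>x y. \<bar>\<beta> x - \<beta> y\<bar> \<le> M * \<bar>x - y\<bar>"
    and c1: "\<And>t. (c1 has_vector_derivative v1 t) (at t)"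
    and v1: "\<And>t. (v1 has_vector_derivative of_real (\<beta> (Re (c1 t))) * (\<i> * v1 t)) (at t)"
    and c2: "\<And>t. (c2 has_vector_derivative v2 t) (at t)"
    and v2: "\<And>t. (v2 has_vector_derivative of_real (\<beta> (Re (c2 t))) * (\<i> * v2 t)) (at t)"
    and norm: "\<And>t. norm (v2 t) = 1"
    and init: "c1 0 = c2 0" "v1 0 = v2 0"
  shows "c1 t = c2 t \<and> v1 t = v2 t"
proof -
  define C where "C t = c1 t - c2 t" for t
  define V where "V t = v1 t - v2 t" for t
  define b where "b t = \<beta> (Re (c1 t)) - \<beta> (Re (c2 t))" for t
  define E where "E t = C t \<bullet> C t + V t \<bullet> V t" for t
  define E' where "E' t = 2 * (C t \<bullet> V t) + 2 * (V t \<bullet> (of_real (b t) * (\<i> * v2 t)))" for t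
  have "M \<ge> 0"
    using lip[of 1 0] by simp
  have C: "(C has_vector_derivative V t) (at t)" for t
    unfolding C_def V_def by (intro derivative_intros c1 c2)
  have V: "(V has_vector_derivative
      of_real (\<beta> (Re (c1 t))) * (\<i> * V t) + of_real (b t) * (\<i> * v2 t)) (at t)" for t
    using has_vector_derivative_diff[OF v1[of t] v2[of t]]
    unfolding V_def by (simp add: b_def algebra_simps)
  have "V t \<bullet> (of_real r * (\<i> * V t)) = 0" for t r
    by (simp add: inner_complex_def algebra_simps)
  then have "(E has_vector_derivative E' t) (at t)" for t
    unfolding E_def E'_def
    by (intro has_vector_derivative_eq_rhs[OF has_vector_derivative_add[OF
            bounded_bilinear.has_vector_derivative[OF bounded_bilinear_inner C C]
            bounded_bilinear.has_vector_derivative[OF bounded_bilinear_inner V V]]])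
       (simp add: inner_add_right inner_add_left inner_commute)
  then have "(E has_real_derivative E' t) (at t)" for t
    by (simp add: has_real_derivative_iff_has_vector_derivative)
  moreover have "\<bar>E' t\<bar> \<le> (1 + M) * E t" for t
  proof -
    have "\<bar>b t\<bar> \<le> M * norm (C t)"
      using lip[of "Re (c1 t)" "Re (c2 t)"] mult_left_mono[OF abs_Re_le_cmod[of "C t"] \<open>M \<ge> 0\<close>]
      by (simp add: b_def C_def)
    then have "\<bar>V t \<bullet> (of_real (b t) * (\<i> * v2 t))\<bar> \<le> norm (V t) * (M * norm (C t))"
      using norm[of t] by (intro order_trans[OF Cauchy_Schwarz_ineq2] mult_left_mono) (auto simp: norm_mult)
    moreover have "\<bar>C t \<bullet> V t\<bar> \<le> norm (C t) * norm (V t)"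
      by (rule Cauchy_Schwarz_ineq2)
    ultimately have "\<bar>E' t\<bar> \<le> (1 + M) * (2 * norm (C t) * norm (V t))"
      by (auto simp: E'_def algebra_simps)
    also have "\<dots> \<le> (1 + M) * ((norm (C t))\<^sup>2 + (norm (V t))\<^sup>2)"
      using \<open>M \<ge> 0\<close> by (intro mult_left_mono sum_squares_bound) auto
    finally show ?thesis
      by (simp add: E_def power2_norm_eq_inner)
  qed
  ultimately have "E t = 0"
    by (rule gronwall_zero) (auto simp: E_def C_def V_def init)
  then show ?thesis
    by (simp add: E_def C_def V_def add_nonneg_eq_0_iff)
qed

section \<open>The magnetic flow on the torus\<close>

lemma torus_proj_eq_iff:
  "torus_proj L z = torus_proj L w \<longleftrightarrow> (\<exists>m n :: int. z = w + Complex (of_int m) (L * of_int n))"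
proof
  assume "torus_proj L z = torus_proj L w"
  moreover have "z \<in> torus_proj L z"
    unfolding torus_proj_def by (rule CollectI, rule exI[of _ 0], rule exI[of _ 0]) (simp add: complex_eq_iff)
  ultimately show "\<exists>m n :: int. z = w + Complex (of_int m) (L * of_int n)"
    by (auto simp: torus_proj_def)
next
  assume "\<exists>m n :: int. z = w + Complex (of_int m) (L * of_int n)"
  then obtain m n :: int where z: "z = w + Complex (of_int m) (L * of_int n)"
    by blast
  have "\<exists>m' n' :: int. z + Complex (of_int i) (L * of_int j) = w + Complex (of_int m') (L * of_int n')" for i j
    by (rule exI[of _ "m + i"], rule exI[of _ "n + j"]) (simp add: z complex_eq_iff algebra_simps)
  moreover have "\<exists>m' n' :: int. w + Complex (of_int i) (L * of_int j) = z + Complex (of_int m') (L * of_int n')" for i j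
    by (rule exI[of _ "i - m"], rule exI[of _ "j - n"]) (simp add: z complex_eq_iff algebra_simps)
  ultimately show "torus_proj L z = torus_proj L w"
    unfolding torus_proj_def by (intro set_eqI iffI) (simp_all, metis+)
qed

lemma torus_proj_add: "torus_proj L z = torus_proj L w \<Longrightarrow> torus_proj L (z + a) = torus_proj L (w + a)"
  by (auto simp: torus_proj_eq_iff algebra_simps)

text \<open>The Lipschitz constant, required for uniqueness of geodesics, is a bound for the
  derivative of the profile, which is continuous and 1-periodic.\<close>

lemma magnetic_profile:
  assumes "magnetic_function L b" "depends_only_on_x L b"
  obtains \<beta> M where "\<And>z. b (torus_proj L z) = \<beta> (Re z)" "continuous_on UNIV \<beta>"
    "\<And>x. \<beta> (x + 1) = \<beta> x" "\<And>x y. \<bar>\<beta> x - \<beta> y\<bar> \<le> M * \<bar>x - y\<bar>"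
proof -
  define F where "F z = b (torus_proj L z)" for z
  define D where "D z = frechet_derivative F (at z)" for z
  define \<beta> where "\<beta> x = F (of_real x)" for x
  define \<beta>' where "\<beta>' x = D (of_real x) 1" for x
  have smooth: "Ck_on (Suc 0) UNIV F"
    using assms(1) unfolding magnetic_function_def smooth_on_def F_def by blast
  have F: "(F has_derivative D z) (at z)" for z
    unfolding D_def by (rule Ck_on_Suc_has_derivative[OF smooth])
  have der: "(\<beta> has_real_derivative \<beta>' x) (at x)" for x
  proof -
    have "(\<beta> has_derivative (\<lambda>h. D (of_real x) (of_real h))) (at x)"
      unfolding \<beta>_def
      by (rule has_derivative_compose[OF bounded_linear_imp_has_derivative[OF bounded_linear_of_real] F])
    moreover have "D (of_real x) (of_real h) = \<beta>' x * h" for h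
      using linear_cmul[OF has_derivative_linear[OF F[of "of_real x"]], of h 1]
      by (simp add: \<beta>'_def scaleR_conv_of_real)
    ultimately show ?thesis
      by (simp add: has_field_derivative_def)
  qed
  have "continuous_on UNIV (\<lambda>z. D z 1)"
    using smooth by (simp add: D_def)
  then have cont': "continuous_on UNIV \<beta>'"
    unfolding \<beta>'_def by (rule continuous_on_compose2) (auto intro: continuous_intros)
  have b: "b (torus_proj L z) = \<beta> (Re z)" for z
    using assms(2)[unfolded depends_only_on_x_def, rule_format, of z "of_real (Re z)"]
    unfolding \<beta>_def F_def by simp
  have per: "\<beta> (x + 1) = \<beta> x" for x
  proof -
    have "of_real (x + 1) = complex_of_real x + Complex (of_int 1) (L * of_int 0)"
      by (simp add: complex_eq_iff)
    then have "torus_proj L (of_real (x + 1)) = torus_proj L (of_real x)"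
      unfolding torus_proj_eq_iff by blast
    then show ?thesis
      by (simp add: \<beta>_def F_def)
  qed
  have per': "\<beta>' (x + 1) = \<beta>' x" for x
    using DERIV_shift[THEN iffD1, OF der[of "x + 1"]] der[of x] per by (simp add: DERIV_unique)
  obtain M where M: "\<And>x. \<bar>\<beta>' x\<bar> \<le> M"
    using periodic_continuous_bounded[OF cont' per'] by blast
  have "\<bar>\<beta> x - \<beta> y\<bar> \<le> M * \<bar>x - y\<bar>" for x y
    using field_differentiable_bound[of UNIV \<beta> \<beta>' M x y] der M by (simp add: norm_conv_dist)
  moreover have "continuous_on UNIV \<beta>"
    using der by (meson DERIV_isCont continuous_at_imp_continuous_on)
  ultimately show thesis
    using b per by (intro that[of \<beta>])
qed

lemma magnetic_geodesic_unique:
  assumes b: "magnetic_function L b" "depends_only_on_x L b"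
    and geo: "magnetic_geodesic L b c v" "magnetic_geodesic L b c' v'"
    and init: "torus_proj L (c 0) = torus_proj L (c' 0)" "v 0 = v' 0"
  shows "torus_proj L (c t) = torus_proj L (c' t) \<and> v t = v' t"
proof -
  obtain \<beta> M where \<beta>: "\<And>z. b (torus_proj L z) = \<beta> (Re z)"
    and lip: "\<And>x y. \<bar>\<beta> x - \<beta> y\<bar> \<le> M * \<bar>x - y\<bar>"
    using magnetic_profile[OF b] by metis
  obtain m n :: int where mn: "c 0 = c' 0 + Complex (of_int m) (L * of_int n)"
    using init(1) by (auto simp: torus_proj_eq_iff)
  \<comment> \<open>Two lifts of the same starting point differ by the lattice vector
    \<open>a\<close>; translating the second curve by \<open>a\<close> reduces the claim to
    uniqueness in the plane.\<close>
  define a where "a = Complex (of_int m) (L * of_int n)"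
  have proj: "torus_proj L (z + a) = torus_proj L z" for z
    unfolding torus_proj_eq_iff a_def by blast
  have "c t = c' t + a \<and> v t = v' t"
  proof (rule magnetic_ode_unique[OF lip])
    show "(c has_vector_derivative v t) (at t)"
      "(v has_vector_derivative complex_of_real (\<beta> (Re (c t))) * (\<i> * v t)) (at t)" for t
      using geo(1) by (simp_all add: magnetic_geodesic_def \<beta>)
    show "((\<lambda>t. c' t + a) has_vector_derivative v' t) (at t)" "norm (v' t) = 1" for t
      using geo(2) by (simp_all add: magnetic_geodesic_def has_vector_derivative_add_const)
    show "(v' has_vector_derivative complex_of_real (\<beta> (Re (c' t + a))) * (\<i> * v' t)) (at t)" for t
      using geo(2) proj \<beta> unfolding magnetic_geodesic_def by metis
  qed (use init mn in \<open>simp_all add: a_def\<close>)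
  then show ?thesis
    by (simp add: proj)
qed

text \<open>Uniqueness gives the description in \<open>magnetic_flow\<close> its value as soon as
  one geodesic is at hand. Existence comes from explicit formulas or from
  \<open>zoll_geodesic\<close>.\<close>

lemma magnetic_flow_eq:
  assumes "magnetic_function L b" "depends_only_on_x L b" "magnetic_geodesic L b c v"
  shows "magnetic_flow L b t (torus_proj L (c 0), v 0) = (torus_proj L (c t), v t)"
  unfolding magnetic_flow_def
proof (rule the_equality)
  fix q
  assume "\<exists>c' v'. magnetic_geodesic L b c' v' \<and>
    (torus_proj L (c' 0), v' 0) = (torus_proj L (c 0), v 0) \<and> (torus_proj L (c' t), v' t) = q"
  then show "q = (torus_proj L (c t), v t)"
    using magnetic_geodesic_unique[OF assms(1,2) _ assms(3)] by (metis Pair_inject)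
qed (use assms in blast)

text \<open>The angle of the velocity serves as parameter, since it grows at the positive rate
  1/\<open>X'\<close>. The time \<open>h\<close> needed to turn by \<theta> has a periodic positive
  derivative, hence an inverse \<open>g\<close>, and substituting \<open>g\<close> restores unit
  speed. The formula covers orbits whether or not they close, so both parts of the theorem use
  it.\<close>

lemma magnetic_flow_explicit:
  fixes X X' Y :: "real \<Rightarrow> real"
  assumes b: "magnetic_function L b" "depends_only_on_x L b"
    and X: "\<And>u. (X has_real_derivative X' u) (at u)" and pos: "\<And>u. X' u > 0"
    and cont: "continuous_on UNIV X'"
    and bX: "\<And>z u. Re z = X u \<Longrightarrow> b (torus_proj L z) = inverse (X' u)"
    and Y: "\<And>\<phi>. (Y has_real_derivative sin \<phi> * X' (K + sin \<phi>)) (at \<phi>)"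
  obtains h where "strict_mono h" "surj h" "h 0 = 0"
    "\<And>\<theta>. magnetic_flow L b (h \<theta>) (torus_proj L (Complex (X (K + sin \<phi>0)) y0), cis \<phi>0) =
       (torus_proj L (Complex (X (K + sin (\<phi>0 + \<theta>))) (y0 + Y (\<phi>0 + \<theta>) - Y \<phi>0)), cis (\<phi>0 + \<theta>))"
proof -
  define f where "f \<theta> = X' (K + sin (\<phi>0 + \<theta>))" for \<theta>
  have f: "continuous_on UNIV f"
    unfolding f_def by (rule continuous_on_compose2[OF cont]) (auto intro!: continuous_intros)
  obtain h where h: "h 0 = 0" "\<And>\<theta>. (h has_real_derivative f \<theta>) (at \<theta>)"
    using real_primitive[OF f] by blast
  have fpos: "f \<theta> > 0" for \<theta>
    by (simp add: f_def pos)
  have per: "h (\<theta> + 2 * pi) = h \<theta> + (h (2 * pi) - h 0)" for \<theta>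
  proof (rule primitive_of_periodic[OF h(2)])
    show "f (x + 2 * pi) = f x" for x
      using sin_periodic[of "\<phi>0 + x"] by (simp add: f_def add.assoc)
  qed
  obtain g where gh: "\<And>\<theta>. g (h \<theta>) = \<theta>" and hg: "\<And>t. h (g t) = t"
    and g: "\<And>t. (g has_real_derivative inverse (f (g t))) (at t)"
    using quasiperiodic_inverse[OF h(2) fpos per] pi_gt_zero by (metis zero_less_mult_iff zero_less_numeral)
  define \<psi> where "\<psi> t = \<phi>0 + g t" for t
  define c where "c t = Complex (X (K + sin (\<psi> t))) (y0 + Y (\<psi> t) - Y \<phi>0)" for t
  define v where "v t = cis (\<psi> t)" for t
  have \<psi>: "(\<psi> has_real_derivative inverse (X' (K + sin (\<psi> t)))) (at t)" for t
    unfolding \<psi>_def using g[of t] by (auto intro!: derivative_eq_intros simp: f_def)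
  have "magnetic_geodesic L b c v"
    unfolding magnetic_geodesic_def
  proof (intro allI conjI)
    fix t
    have "X' (K + sin (\<psi> t)) \<noteq> 0"
      using pos[of "K + sin (\<psi> t)"] by simp
    have sin: "((\<lambda>t. K + sin (\<psi> t)) has_real_derivative cos (\<psi> t) * inverse (X' (K + sin (\<psi> t)))) (at t)"
      by (rule derivative_eq_intros \<psi> refl)+ simp
    have "((\<lambda>t. X (K + sin (\<psi> t))) has_real_derivative cos (\<psi> t)) (at t)"
      using DERIV_chain2[OF X sin] \<open>X' (K + sin (\<psi> t)) \<noteq> 0\<close> by (simp add: field_simps)
    moreover have "((\<lambda>t. y0 + Y (\<psi> t) - Y \<phi>0) has_real_derivative sin (\<psi> t)) (at t)"
      using DERIV_chain2[OF Y \<psi>[of t]] \<open>X' (K + sin (\<psi> t)) \<noteq> 0\<close>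
      by (auto intro!: derivative_eq_intros simp: field_simps)
    ultimately show "(c has_vector_derivative v t) (at t)"
      by (simp add: has_vector_derivative_complex_iff c_def v_def)
    show "norm (v t) = 1"
      by (simp add: v_def)
    have "b (torus_proj L (c t)) = inverse (X' (K + sin (\<psi> t)))"
      by (rule bX) (simp add: c_def)
    moreover have "((\<lambda>t. cos (\<psi> t)) has_real_derivative - sin (\<psi> t) * inverse (X' (K + sin (\<psi> t)))) (at t)"
      by (rule derivative_eq_intros \<psi> refl)+
    moreover have "((\<lambda>t. sin (\<psi> t)) has_real_derivative cos (\<psi> t) * inverse (X' (K + sin (\<psi> t)))) (at t)"
      by (rule derivative_eq_intros \<psi> refl)+
    moreover have rot: "Re (of_real r * (\<i> * cis a)) = - sin a * r" "Im (of_real r * (\<i> * cis a)) = cos a * r" for r a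
      by simp_all
    ultimately show "(v has_vector_derivative of_real (b (torus_proj L (c t))) * (\<i> * v t)) (at t)"
      by (simp only: rot has_vector_derivative_complex_iff v_def cis.sel)
  qed
  note flow = magnetic_flow_eq[OF b this]
  show thesis
  proof (rule that)
    show "strict_mono h"
      using DERIV_pos_imp_increasing[of _ _ h] h(2) fpos by (metis strict_monoI)
    show "surj h"
      using hg by (metis surjI)
    show "h 0 = 0"
      by (rule h)
    have "g 0 = 0"
      using gh[of 0] h(1) by simp
    then show "magnetic_flow L b (h \<theta>) (torus_proj L (Complex (X (K + sin \<phi>0)) y0), cis \<phi>0) =
       (torus_proj L (Complex (X (K + sin (\<phi>0 + \<theta>))) (y0 + Y (\<phi>0 + \<theta>) - Y \<phi>0)), cis (\<phi>0 + \<theta>))" for \<theta>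
      using flow[of "h \<theta>"] by (simp add: c_def v_def \<psi>_def gh)
  qed
qed

section \<open>From closed orbits to a free circle action\<close>

lemma cis_eqE:
  assumes "cis a = cis b"
  obtains n :: int where "a = b + of_int n * (2 * pi)"
  using assms sin_cos_eq_iff[of a b] by (auto simp: complex_eq_iff mult_ac)

lemma unit_complex_cisE:
  assumes "u \<in> sphere 0 1"
  obtains \<theta> where "u = cis \<theta>"
  using assms cis_Arg[of u] by (metis dist_0_norm div_by_1 mem_sphere norm_zero sgn_eq zero_neq_one of_real_1)

text \<open>
  The periodicity of \<open>Y\<close> in its second argument says that the displacement vanishes, that of the first
  one makes the action well defined on the torus. The primitive \<open>Y\<close> is a parameter because its joint
  smoothness is immediate only for explicit formulas.
\<close>
lemma zoll_of_closed_orbits: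
  fixes X X' B :: "real \<Rightarrow> real" and Y :: "real \<Rightarrow> real \<Rightarrow> real"
  assumes b: "magnetic_function L b" "depends_only_on_x L b"
    and X: "\<And>u. (X has_real_derivative X' u) (at u)" and pos: "\<And>u. X' u > 0"
    and smooth: "smooth_on UNIV X'" "smooth_on UNIV B"
    and XB: "\<And>x. X (B x) = x" and BX: "\<And>u. B (X u) = u"
    and per: "\<And>u. X (u + T) = X u + 1"
    and bB: "\<And>z. b (torus_proj L z) = inverse (X' (B (Re z)))"
    and Y: "\<And>K \<phi>. (Y K has_real_derivative sin \<phi> * X' (K + sin \<phi>)) (at \<phi>)"
    and perK: "\<And>K \<phi>. Y (K + T) \<phi> = Y K \<phi>" and per\<phi>: "\<And>K \<phi>. Y K (\<phi> + 2 * pi) = Y K \<phi>"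
    and smoothY: "\<And>f g :: real \<times> complex \<times> real \<Rightarrow> real. smooth_on UNIV f \<Longrightarrow> smooth_on UNIV g \<Longrightarrow>
      smooth_on UNIV (\<lambda>w. Y (f w) (g w))"
  shows "zoll L b"
proof -
  define Z where "Z K \<phi> = Complex (X (K + sin \<phi>)) (Y K \<phi>)" for K \<phi>
  \<comment> \<open>\<open>B x - sin \<phi>\<close> is the energy of the state with abscissa
    \<open>x\<close> and angle \<phi>, and \<open>Z\<close> its orbit in terms of the angle;
    \<open>D\<close> is the displacement while the angle turns by \<theta>.\<close>
  define D where "D x \<phi> \<theta> = Z (B x - sin \<phi>) (\<phi> + \<theta>) - Z (B x - sin \<phi>) \<phi>" for x \<phi> \<theta>
  \<comment> \<open>\<open>SOME\<close> and \<open>Arg\<close> choose an arbitrary lift of the point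
    and of both angles; the periodicities \<open>D1\<close>, \<open>D2\<close> and \<open>D3\<close>
    remove the dependence on this choice.\<close>
  define A where "A u p = (let z = (SOME z. fst p = torus_proj L z) in
    (torus_proj L (z + D (Re z) (Arg (snd p)) (Arg u)), u * snd p))" for u :: complex and p
  have ZT: "Z (K + of_int n * T) \<phi> = Z K \<phi> + of_int n" for n :: int and K \<phi>
    using quasiperiodic_int[of X T 1 "K + sin \<phi>" n] per
      quasiperiodic_int[of "\<lambda>K. Y K \<phi>" T 0 K n] perK by (simp add: Z_def complex_eq_iff algebra_simps)
  have Zpi: "Z K (\<phi> + of_int n * (2 * pi)) = Z K \<phi>" for n :: int and K \<phi>
    using quasiperiodic_int[of "\<lambda>\<phi>. sin \<phi>" "2 * pi" 0 \<phi> n]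
      quasiperiodic_int[of "Y K" "2 * pi" 0 \<phi> n] per\<phi> by (simp add: Z_def)
  have sinpi: "sin (\<phi> + of_int n * (2 * pi)) = sin \<phi>" for n :: int and \<phi> :: real
    using quasiperiodic_int[of "\<lambda>\<phi>. sin \<phi>" "2 * pi" 0 \<phi> n] by simp
  have "B (x + 1) = B x + T" for x
    using per[of "B x"] XB BX by metis
  then have BT: "B (x + of_int n) = B x + of_int n * T" for n :: int and x
    using quasiperiodic_int[of B 1 T x n] by simp
  have D1: "D (x + of_int n) \<phi> \<theta> = D x \<phi> \<theta>" for n :: int and x \<phi> \<theta>
    using ZT[of "B x - sin \<phi>" n] by (simp add: D_def BT algebra_simps)
  have D2: "D x (\<phi> + of_int n * (2 * pi)) \<theta> = D x \<phi> \<theta>" for n :: int and x \<phi> \<theta>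
    using Zpi[of _ \<phi> n] Zpi[of _ "\<phi> + \<theta>" n] unfolding D_def sinpi by (simp add: add_ac)
  have D3: "D x \<phi> (\<theta> + of_int n * (2 * pi)) = D x \<phi> \<theta>" for n :: int and x \<phi> \<theta>
    using Zpi[of _ "\<phi> + \<theta>" n] by (simp add: D_def algebra_simps)
  have A: "A (cis \<theta>) (torus_proj L z, cis \<phi>) = (torus_proj L (z + D (Re z) \<phi> \<theta>), cis (\<phi> + \<theta>))" for \<theta> \<phi> z
  proof -
    define w where "w = (SOME w. torus_proj L z = torus_proj L w)"
    have w: "torus_proj L z = torus_proj L w"
      unfolding w_def by (rule someI[of _ z]) simp
    then obtain m n :: int where "z = w + Complex (of_int m) (L * of_int n)"
      by (auto simp: torus_proj_eq_iff)
    then have Re: "Re z = Re w + of_int m"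
      by simp
    obtain i where i: "\<phi> = Arg (cis \<phi>) + of_int i * (2 * pi)"
      by (rule cis_eqE[of \<phi> "Arg (cis \<phi>)"]) (simp add: cis_Arg)
    obtain j where j: "\<theta> = Arg (cis \<theta>) + of_int j * (2 * pi)"
      by (rule cis_eqE[of \<theta> "Arg (cis \<theta>)"]) (simp add: cis_Arg)
    have "D (Re z) \<phi> \<theta> = D (Re w) (Arg (cis \<phi>)) (Arg (cis \<theta>))"
      unfolding Re D1 by (subst i, subst j) (simp only: D2 D3)
    moreover have "A (cis \<theta>) (torus_proj L z, cis \<phi>) =
        (torus_proj L (w + D (Re w) (Arg (cis \<phi>)) (Arg (cis \<theta>))), cis \<theta> * cis \<phi>)"
      by (simp add: A_def w_def[symmetric])
    ultimately show ?thesis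
      using torus_proj_add[OF w, of "D (Re z) \<phi> \<theta>"] by (simp add: cis_mult add.commute)
  qed
  have D0: "D x \<phi> 0 = 0" for x \<phi>
    by (simp add: D_def)
  have step: "x + Re (D x \<phi> \<theta>) = X (B x - sin \<phi> + sin (\<phi> + \<theta>))" for x \<phi> \<theta>
    by (simp add: D_def Z_def XB)
  \<comment> \<open>Cocycle identity: after the turn by \<theta> the energy is still
    \<open>B x - sin \<phi>\<close>, so the intermediate values of \<open>Z\<close> cancel.\<close>
  have Dadd: "D x \<phi> (\<eta> + \<theta>) = D x \<phi> \<theta> + D (x + Re (D x \<phi> \<theta>)) (\<phi> + \<theta>) \<eta>" for x \<phi> \<theta> \<eta>
    unfolding step by (simp add: D_def BX add_ac)
  have polar: "\<exists>z \<phi>. p = (torus_proj L z, cis \<phi>)" if "p \<in> unit_tangent_bundle L" for p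
    using that unit_complex_cisE[of "snd p"]
    by (auto simp: unit_tangent_bundle_def torus_def mem_Times_iff prod_eq_iff)
  have smX: "smooth_on UNIV X"
    using X smooth(1) by (rule smooth_on_real_primitive)
  have linear: "smooth_on UNIV (\<lambda>w::real \<times> complex \<times> real. fst w)"
    "smooth_on UNIV (\<lambda>w::real \<times> complex \<times> real. snd (snd w))"
    "smooth_on UNIV (\<lambda>w::real \<times> complex \<times> real. fst (snd w))"
    "smooth_on UNIV (\<lambda>w::real \<times> complex \<times> real. Re (fst (snd w)))"
    by (intro smooth_on_bounded_linear bounded_linear_intros bounded_linear_compose[OF bounded_linear_Re])+
  have action: "smooth_free_circle_action L A"
    unfolding smooth_free_circle_action_def
  proof (intro conjI ballI impI)
    fix u :: complex and p assume u: "u \<in> sphere 0 1" and p: "p \<in> unit_tangent_bundle L"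
    obtain \<theta> where \<theta>: "u = cis \<theta>"
      using u unit_complex_cisE by blast
    obtain z \<phi> where z: "p = (torus_proj L z, cis \<phi>)"
      using polar[OF p] by blast
    show "A u p \<in> unit_tangent_bundle L"
      by (simp add: \<theta> z A unit_tangent_bundle_def torus_def)
    show "A (u * w) p = A u (A w p)" if w: "w \<in> sphere 0 1" for w
    proof -
      obtain \<eta> where \<eta>: "w = cis \<eta>"
        using w unit_complex_cisE by blast
      show ?thesis
        unfolding \<theta> \<eta> z cis_mult A Dadd[of "Re z" \<phi> \<theta> \<eta>] by (simp add: add.assoc add.commute[of \<theta> \<eta>])
    qed
    show "u = 1" if "A u p = p"
      using that by (simp add: A_def z Let_def)
  next
    fix p assume p: "p \<in> unit_tangent_bundle L"
    then obtain z \<phi> where z: "p = (torus_proj L z, cis \<phi>)"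
      using polar by blast
    show "A 1 p = p"
      using A[of 0 z \<phi>] by (simp add: z D0)
  next
    have "smooth_on UNIV (\<lambda>w::real \<times> complex \<times> real. fst (snd w) + D (Re (fst (snd w))) (snd (snd w)) (fst w))"
      unfolding D_def Z_def
      by (intro smooth_on_add smooth_on_diff smooth_on_Complex smooth_on_real_compose[OF smX] smoothY
          smooth_on_real_compose[OF smooth_on_sin] smooth_on_real_compose[OF smooth(2)] linear)
    then show "smooth_to_torus L (\<lambda>(\<theta>, z, \<phi>). fst (A (cis \<theta>) (torus_proj L z, cis \<phi>)))"
      unfolding smooth_to_torus_def by (intro allI exI[of _ UNIV] exI) (auto simp: A)
    have "smooth_on UNIV (\<lambda>w::real \<times> complex \<times> real.
        Complex (cos (snd (snd w) + fst w)) (sin (snd (snd w) + fst w)))"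
      by (intro smooth_on_add smooth_on_Complex smooth_on_real_compose[OF smooth_on_sin]
          smooth_on_real_compose[OF smooth_on_cos] linear)
    then show "smooth_on UNIV (\<lambda>(\<theta>, z, \<phi>). snd (A (cis \<theta>) (torus_proj L z, cis \<phi>)))"
      unfolding cis.code[symmetric] by (simp only: case_prod_unfold A snd_conv)
  qed
  have contX': "continuous_on UNIV X'"
    using smooth(1) Ck_on.simps(1) unfolding smooth_on_def by blast
  have orbits: "\<exists>h::real \<Rightarrow> real. strict_mono h \<and> surj h \<and> h 0 = 0 \<and>
      (\<forall>\<tau>. A (cis \<tau>) p = magnetic_flow L b (h \<tau>) p)" if p: "p \<in> unit_tangent_bundle L" for p
  proof -
    obtain z \<phi> where z: "p = (torus_proj L z, cis \<phi>)"
      using polar[OF p] by blast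
    define K where "K = B (Re z) - sin \<phi>"
    have z0: "Complex (X (K + sin \<phi>)) (Im z) = z"
      by (simp add: K_def XB)
    have bX: "b (torus_proj L z) = inverse (X' u)" if "Re z = X u" for z u
      by (simp add: bB that BX)
    obtain h where h: "strict_mono h" "surj h" "h 0 = 0"
      "\<And>\<theta>. magnetic_flow L b (h \<theta>) (torus_proj L (Complex (X (K + sin \<phi>)) (Im z)), cis \<phi>) =
       (torus_proj L (Complex (X (K + sin (\<phi> + \<theta>))) (Im z + Y K (\<phi> + \<theta>) - Y K \<phi>)), cis (\<phi> + \<theta>))"
      using magnetic_flow_explicit[OF b X pos contX' bX Y[of K], of \<phi> "Im z"] by blast
    have "z + D (Re z) \<phi> \<theta> = Complex (X (K + sin (\<phi> + \<theta>))) (Im z + Y K (\<phi> + \<theta>) - Y K \<phi>)" for \<theta>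
      by (simp add: D_def Z_def K_def[symmetric] complex_eq_iff) (simp add: K_def XB)
    then have "A (cis \<theta>) p = magnetic_flow L b (h \<theta>) p" for \<theta>
      using h(4)[of \<theta>] by (simp add: z A z0)
    then show ?thesis
      using h(1-3) by blast
  qed
  show ?thesis
    unfolding zoll_def using action orbits by blast
qed

section \<open>Bessel's integral and the average on the torus\<close>

text \<open>Wallis' integrals: sin^(2m+1) cos vanishes at both ends, so integrating its derivative
  gives I_(m+1) = (2m+1)/(2m+2) I_m.\<close>

lemma has_integral_sin_power_even:
  "((\<lambda>x. sin x ^ (2 * m)) has_integral 2 * pi * fact (2 * m) / (4 ^ m * (fact m)\<^sup>2)) {0..2 * pi::real}"
proof (induction m)
  case 0
  show ?case
    using has_integral_const_real[of "1::real" 0 "2 * pi"] by simp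
next
  case (Suc m)
  let ?I = "2 * pi * fact (2 * m) / (4 ^ m * (fact m)\<^sup>2) :: real"
  have "((\<lambda>x. (2 * real m + 1) * sin x ^ (2 * m) - (2 * real m + 2) * sin x ^ (2 * Suc m))
      has_integral (sin (2 * pi) ^ (2 * m + 1) * cos (2 * pi) - sin 0 ^ (2 * m + 1) * cos 0)) {0..2 * pi}"
  proof (rule fundamental_theorem_of_calculus)
    fix x :: real
    have "((\<lambda>x. sin x ^ (2 * m + 1) * cos x) has_real_derivative
        (2 * real m + 1) * sin x ^ (2 * m) * cos x * cos x - sin x ^ (2 * m + 1) * sin x) (at x within {0..2 * pi})"
      by (rule derivative_eq_intros refl)+ (simp add: algebra_simps)
    moreover have "cos x * cos x = 1 - sin x * sin x"
      using sin_cos_squared_add[of x] by (simp add: power2_eq_square)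
    then have "(2 * real m + 1) * sin x ^ (2 * m) * cos x * cos x = (2 * real m + 1) * sin x ^ (2 * m) * (1 - sin x * sin x)"
      by (simp only: mult.assoc)
    then have "(2 * real m + 1) * sin x ^ (2 * m) * cos x * cos x - sin x ^ (2 * m + 1) * sin x =
        (2 * real m + 1) * sin x ^ (2 * m) - (2 * real m + 2) * sin x ^ (2 * Suc m)"
      by (simp add: algebra_simps)
    ultimately show "((\<lambda>x. sin x ^ (2 * m + 1) * cos x) has_vector_derivative
        (2 * real m + 1) * sin x ^ (2 * m) - (2 * real m + 2) * sin x ^ (2 * Suc m)) (at x within {0..2 * pi})"
      by (simp add: has_real_derivative_iff_has_vector_derivative)
  qed simp
  then have "((\<lambda>x. (2 * real m + 1) * sin x ^ (2 * m) -
      ((2 * real m + 1) * sin x ^ (2 * m) - (2 * real m + 2) * sin x ^ (2 * Suc m)))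
      has_integral ((2 * real m + 1) * ?I - 0)) {0..2 * pi}"
    by (intro has_integral_diff has_integral_mult_right Suc) simp
  then have "((\<lambda>x. 1 / (2 * real m + 2) * ((2 * real m + 2) * sin x ^ (2 * Suc m)))
      has_integral (1 / (2 * real m + 2) * ((2 * real m + 1) * ?I))) {0..2 * pi}"
    by (intro has_integral_mult_right) simp
  moreover have "2 * real m + 2 \<noteq> 0"
    by linarith
  then have "1 / (2 * real m + 2) * ((2 * real m + 2) * y) = y" for y
    by simp
  moreover have "1 / (2 * real m + 2) * ((2 * real m + 1) * ?I) =
      2 * pi * fact (2 * Suc m) / (4 ^ Suc m * (fact (Suc m))\<^sup>2)"
  proof -
    have "fact (2 * Suc m) = (2 * real m + 2) * ((2 * real m + 1) * fact (2 * m))"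
      by (simp add: algebra_simps)
    moreover have "4 ^ Suc m * (fact (Suc m))\<^sup>2 = (2 * real m + 2) * ((2 * real m + 2) * (4 ^ m * (fact m)\<^sup>2))"
      by (simp add: algebra_simps power2_eq_square)
    ultimately show ?thesis
      using \<open>2 * real m + 2 \<noteq> 0\<close> by (simp only: mult.left_commute[of "2 * pi"]) simp
  qed
  ultimately show ?case
    by simp
qed

text \<open>Expanding sin (k sin x) in its power series and integrating term by term with Wallis'
  integrals produces the series of J_1.\<close>

lemma bessel_J1_integral:
  "((\<lambda>x. sin x * sin (k * sin x)) has_integral 2 * pi * bessel_J 1 k) {0..2 * pi}"
proof -
  define a where "a m x = (- 1) ^ m / fact (2 * m + 1) * k ^ (2 * m + 1) * sin x ^ (2 * Suc m)" for m x
  define b where "b m = (- 1) ^ m / (fact m * fact (m + 1)) * (k / 2) ^ (2 * m + 1)" for m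
  have a_int: "(a m has_integral 2 * pi * b m) {0..2 * pi}" for m
  proof -
    have "(a m has_integral ((- 1) ^ m / fact (2 * m + 1) * k ^ (2 * m + 1)) *
        (2 * pi * fact (2 * Suc m) / (4 ^ Suc m * (fact (Suc m))\<^sup>2))) {0..2 * pi}"
      unfolding a_def by (intro has_integral_mult_right has_integral_sin_power_even)
    moreover have "(- 1) ^ m / fact (2 * m + 1) * k ^ (2 * m + 1) *
        (2 * pi * fact (2 * Suc m) / (4 ^ Suc m * (fact (Suc m))\<^sup>2)) = 2 * pi * b m"
    proof -
      have "fact (2 * Suc m) = 2 * (real m + 1) * fact (2 * m + 1)"
        by (simp add: algebra_simps)
      moreover have "(k / 2) ^ (2 * m + 1) = 2 * k ^ (2 * m + 1) / 4 ^ Suc m"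
        by (simp add: power_divide power_mult)
      moreover have "(4::real) ^ m = 2 ^ (2 * m)"
        by (simp add: power_mult)
      moreover have "fact (Suc m) = (real m + 1) * fact m"
        by simp
      moreover have "real m + 1 \<noteq> 0"
        by linarith
      ultimately show ?thesis
        by (simp add: b_def power2_eq_square divide_simps del: fact_Suc) 
    qed
    ultimately show ?thesis
      by simp
  qed
  have sums: "(\<lambda>m. a m x) sums (sin x * sin (k * sin x))" for x
  proof -
    have "(\<lambda>m. sin x * ((- 1) ^ m / fact (2 * m + 1) * (k * sin x) ^ (2 * m + 1))) sums (sin x * sin (k * sin x))"
      by (intro sums_mult sin_paired)
    then show ?thesis
      by (simp add: a_def power_mult_distrib mult_ac)
  qed
  have "uniform_limit {0..2 * pi} (\<lambda>n x. \<Sum>m<n. a m x) (\<lambda>x. \<Sum>m. a m x) sequentially"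
  proof (rule Weierstrass_m_test)
    show "norm (a m x) \<le> 1 / fact (2 * m + 1) * \<bar>k\<bar> ^ (2 * m + 1)" for m x
      using power_le_one[of "\<bar>sin x\<bar>" "2 * Suc m"]
        mult_left_mono[of "\<bar>sin x\<bar> ^ (2 * Suc m)" 1 "1 / fact (2 * m + 1) * \<bar>k\<bar> ^ (2 * m + 1)"]
      by (simp add: a_def abs_mult power_abs del: power_Suc fact_Suc)
    have "summable (\<lambda>n. \<bar>k\<bar> ^ n /\<^sub>R fact n)"
      by (rule summable_exp_generic)
    then have "summable (\<lambda>n. 1 / fact n * \<bar>k\<bar> ^ n)"
      by (simp add: divide_inverse)
    \<comment> \<open>The majorant is the odd part of the exponential series at |k|; deleting the
      even terms and reindexing gives its summability.\<close>
    then have "summable (\<lambda>n. if odd n then 1 / fact n * \<bar>k\<bar> ^ n else 0)"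
      by (rule summable_comparison_test'[where N = 0]) simp
    moreover have "strict_mono (\<lambda>m::nat. 2 * m + 1)"
      by (auto intro: strict_monoI)
    then have "summable (\<lambda>m. if odd (2 * m + 1) then 1 / fact (2 * m + 1) * \<bar>k\<bar> ^ (2 * m + 1) else 0) \<longleftrightarrow>
        summable (\<lambda>n. if odd n then 1 / fact n * \<bar>k\<bar> ^ n else 0)"
      by (rule summable_mono_reindex[where f = "\<lambda>n. if odd n then 1 / fact n * \<bar>k\<bar> ^ n else 0"])
         (auto elim!: oddE)
    ultimately show "summable (\<lambda>m. 1 / fact (2 * m + 1) * \<bar>k\<bar> ^ (2 * m + 1))"
      by (simp del: fact_Suc power_Suc)
  qed
  moreover have "(\<Sum>m. a m x) = sin x * sin (k * sin x)" for x
    using sums by (simp add: sums_iff)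
  ultimately have "uniform_limit {0..2 * pi} (\<lambda>n x. \<Sum>m<n. a m x) (\<lambda>x. sin x * sin (k * sin x)) sequentially"
    by simp
  then obtain I J where IJ: "\<And>n. ((\<lambda>x. \<Sum>m<n. a m x) has_integral I n) {0..2 * pi}"
    "((\<lambda>x. sin x * sin (k * sin x)) has_integral J) {0..2 * pi}" "I \<longlonglongrightarrow> J"
    by (rule uniform_limit_integral) (auto simp: a_def intro!: continuous_intros)
  have "I n = (\<Sum>m<n. 2 * pi * b m)" for n
    using has_integral_unique[OF IJ(1) has_integral_sum[of "{..<n}" a]] a_int by simp
  then have "(\<lambda>m. 2 * pi * b m) sums J"
    using IJ(3) unfolding sums_def by presburger
  then have "b sums (J / (2 * pi))"
    using sums_divide[of "\<lambda>m. 2 * pi * b m" J "2 * pi"] by simp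
  then have "J = 2 * pi * bessel_J 1 k"
    unfolding bessel_J_def b_def by (simp add: sums_iff)
  then show ?thesis
    using IJ(2) by simp
qed

text \<open>The box in \<open>complex\<close> is transported to \<open>real \<times> real\<close>,
  where Fubini separates the variables; the change of coordinates preserves boxes and their measure.
  The factor \<open>L\<close> cancels in the average.\<close>

lemma torus_average_eq:
  assumes "L > 0" and b: "\<And>z. b (torus_proj L z) = \<beta> (Re z)" and cont: "continuous_on UNIV \<beta>"
  shows "torus_average L b = integral {0..1} \<beta>"
proof -
  have cbox_complex: "cbox a b = (\<lambda>(x, y). Complex x y) ` cbox (Re a, Im a) (Re b, Im b)" for a b
    by (cases a; cases b) (simp add: cbox_Complex_eq cbox_Pair_eq)
  have inv: "(\<lambda>z. (Re z, Im z)) ` (\<lambda>(x, y). Complex x y) ` S = S" for S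
    by (force simp: image_iff)
  have content: "measure lborel (cbox a b) = measure lborel (cbox (Re a, Im a) (Re b, Im b))" for a b :: complex
    unfolding content_Pair content_cbox_if[of a b]
    by (auto simp: Basis_complex_def box_eq_empty inner_complex_def content_real_if)
  have integral: "torus_integral L (\<lambda>q. f q) = L * integral {0..1} g"
    if f: "\<And>z. f (torus_proj L z) = g (Re z)" and g: "continuous_on UNIV g" for f g
  proof -
    have cont: "continuous_on (cbox (0, 0) (1, L)) (\<lambda>p. g (fst p))"
      by (rule continuous_on_compose2[OF g]) (auto intro: continuous_intros)
    then have "((\<lambda>p. g (fst p)) has_integral integral (cbox (0, 0) (1, L)) (\<lambda>p. g (fst p))) (cbox (0, 0) (1, L))"
      by (intro integrable_integral integrable_continuous)
    moreover have "integral (cbox (0, 0) (1, L)) (\<lambda>p. g (fst p)) = L * integral {0..1} g"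
      using integral_prod_continuous[OF cont] \<open>L > 0\<close> by simp
    ultimately have "((\<lambda>p. g (fst p)) has_integral L * integral {0..1} g) (cbox (0, 0) (1, L))"
      by simp
    then have "((\<lambda>z. g (fst (Re z, Im z))) has_integral (1 / 1) *\<^sub>R (L * integral {0..1} g))
        ((\<lambda>(x, y). Complex x y) ` cbox (0, 0) (1, L))"
    proof (intro has_integral_twiddle)
      fix u v :: complex
      have "(\<lambda>z. (Re z, Im z)) ` cbox u v = cbox (Re u, Im u) (Re v, Im v)"
        unfolding cbox_complex inv ..
      then show "\<exists>w z. (\<lambda>z. (Re z, Im z)) ` cbox u v = cbox w z"
        and "measure lborel ((\<lambda>z. (Re z, Im z)) ` cbox u v) = 1 * measure lborel (cbox u v)"
        by (auto simp: content)
    next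
      fix u v :: "real \<times> real"
      have "(\<lambda>(x, y). Complex x y) ` cbox u v = cbox (Complex (fst u) (snd u)) (Complex (fst v) (snd v))"
        by (simp add: cbox_complex)
      then show "\<exists>w z. (\<lambda>(x, y). Complex x y) ` cbox u v = cbox w z"
        by blast
    qed (auto intro!: continuous_intros)
    moreover have "(\<lambda>(x, y). Complex x y) ` cbox (0, 0) (1, L) = cbox 0 (Complex 1 L)"
      by (simp add: cbox_complex[of 0 "Complex 1 L"])
    ultimately show ?thesis
      unfolding torus_integral_def f by (simp add: integral_unique)
  qed
  have "torus_integral L b = L * integral {0..1} \<beta>"
    using integral[OF b cont] by simp
  moreover have "torus_integral L (\<lambda>_. 1) = L * integral {0..1} (\<lambda>_::real. 1)"
    by (rule integral) auto
  ultimately show ?thesis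
    using \<open>L > 0\<close> by (simp add: torus_average_def)
qed

section \<open>Uniqueness of Fourier coefficients\<close>

text \<open>Admitting complex-valued \<open>G\<close> and all integers m at once makes the property
  stable under multiplication by a mode, hence by trigonometric polynomials.\<close>

definition orthogonal_to_modes :: "real \<Rightarrow> (real \<Rightarrow> complex) \<Rightarrow> bool" where
  "orthogonal_to_modes T G \<longleftrightarrow> continuous_on UNIV G \<and>
     (\<forall>m::int. ((\<lambda>u. G u * cis (of_int m * (2 * pi / T) * u)) has_integral 0) {0..T})"

lemma orthogonal_to_modes_add:
  assumes "orthogonal_to_modes T G" "orthogonal_to_modes T H"
  shows "orthogonal_to_modes T (\<lambda>u. G u + H u)"
proof -
  have "((\<lambda>u. (G u + H u) * cis (of_int m * (2 * pi / T) * u)) has_integral 0) {0..T}" for m :: int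
    using has_integral_add[of "\<lambda>u. G u * cis (of_int m * (2 * pi / T) * u)" 0 "{0..T}"
        "\<lambda>u. H u * cis (of_int m * (2 * pi / T) * u)" 0] assms
    by (simp add: orthogonal_to_modes_def ring_distribs)
  then show ?thesis
    using assms by (auto simp: orthogonal_to_modes_def intro: continuous_intros)
qed

lemma orthogonal_to_modes_cmult:
  assumes "orthogonal_to_modes T G"
  shows "orthogonal_to_modes T (\<lambda>u. G u * c)"
proof -
  have "((\<lambda>u. (G u * c) * cis (of_int m * (2 * pi / T) * u)) has_integral 0) {0..T}" for m :: int
    using has_integral_mult_left[of "\<lambda>u. G u * cis (of_int m * (2 * pi / T) * u)" 0 "{0..T}" c] assms
    by (simp add: orthogonal_to_modes_def mult_ac)
  then show ?thesis
    using assms by (auto simp: orthogonal_to_modes_def intro: continuous_intros)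
qed

lemma orthogonal_to_modes_cis:
  assumes "orthogonal_to_modes T G"
  shows "orthogonal_to_modes T (\<lambda>u. G u * cis (of_int n * (2 * pi / T) * u))"
proof -
  have "((\<lambda>u. (G u * cis (of_int n * (2 * pi / T) * u)) * cis (of_int m * (2 * pi / T) * u)) has_integral 0) {0..T}" for m :: int
    using assms[unfolded orthogonal_to_modes_def, THEN conjunct2, rule_format, of "n + m"]
    by (simp add: mult.assoc cis_mult ring_distribs add_divide_distrib)
  moreover have "continuous_on UNIV (\<lambda>u. cis (c * u))" for c
    unfolding cis_conv_exp by (intro continuous_intros)
  ultimately show ?thesis
    using assms unfolding orthogonal_to_modes_def by (intro conjI allI continuous_on_mult) blast+
qed

text \<open>
  The statement quantifies over all \<open>G\<close> so that the induction passes through products of polynomials.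
\<close>
lemma orthogonal_to_modes_polynomial:
  fixes p :: "complex \<Rightarrow> real"
  assumes "real_polynomial_function p" "orthogonal_to_modes T G"
  shows "orthogonal_to_modes T (\<lambda>u. G u * of_real (p (cis (2 * pi / T * u))))"
  using assms
proof (induction arbitrary: G)
  case (linear f)
  \<comment> \<open>A real linear form on the unit circle is c e^(ix) plus its conjugate, so it
    shifts the modes by one in either direction.\<close>
  define c where "c = (of_real (f 1) - \<i> * of_real (f \<i>)) / 2"
  have "complex_of_real (f (cis x)) = c * cis x + cnj c * cis (- x)" for x
  proof -
    have "cis x = cos x *\<^sub>R 1 + sin x *\<^sub>R \<i>"
      by (simp add: complex_eq_iff)
    moreover have "linear f"
      using linear.hyps by (rule bounded_linear.linear)
    ultimately have "f (cis x) = cos x * f 1 + sin x * f \<i>"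
      by (simp only: linear_add linear_cmul real_scaleR_def)
    then show ?thesis
      by (simp add: c_def complex_eq_iff field_simps)
  qed
  then have "G u * of_real (f (cis (2 * pi / T * u))) =
      G u * cis (of_int 1 * (2 * pi / T) * u) * c + G u * cis (of_int (- 1) * (2 * pi / T) * u) * cnj c" for u
    by (simp add: algebra_simps)
  then show ?case
    using linear.prems
    by (simp only:) (intro orthogonal_to_modes_add orthogonal_to_modes_cmult orthogonal_to_modes_cis)
next
  case (const c)
  then show ?case
    by (rule orthogonal_to_modes_cmult)
next
  case (add f g)
  then show ?case
    using orthogonal_to_modes_add[OF add.IH(1) add.IH(2), OF add.prems add.prems] by (simp add: ring_distribs)
next
  case (mult f g)
  then show ?case
    using mult.IH(2)[OF mult.IH(1)[OF mult.prems]] by (simp add: mult.assoc)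
qed

text \<open>\<open>Arg\<close> jumps on the negative real axis and \<open>Arg2pi\<close> on the
  positive one, but by periodicity both give the same function on the circle, so at each point one
  of them proves continuity.\<close>

lemma continuous_on_circle_of_periodic:
  fixes g :: "real \<Rightarrow> real"
  assumes g: "continuous_on UNIV g" and per: "\<And>x. g (x + 2 * pi) = g x"
  obtains f :: "complex \<Rightarrow> real" where "continuous_on (sphere 0 1) f" "\<And>x. f (cis x) = g x"
proof -
  define f where "f z = g (Arg z)" for z
  have perint: "g (x + of_int n * (2 * pi)) = g x" for x and n :: int
    using quasiperiodic_int[of g "2 * pi" 0 x n] per by simp
  have cis: "f (cis x) = g x" for x
  proof -
    obtain n where "x = Arg (cis x) + of_int n * (2 * pi)"
      by (rule cis_eqE[of x "Arg (cis x)"]) (simp add: cis_Arg)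
    then show ?thesis
      using perint[of "Arg (cis x)" n] by (simp add: f_def)
  qed
  have Arg2pi: "f z = g (Arg2pi z)" if "z \<in> sphere 0 1" for z
  proof -
    have "z = cis (Arg2pi z)"
      using Arg2pi[of z] that by (simp add: is_Arg_def cis_conv_exp)
    then show ?thesis
      using cis by metis
  qed
  have isCont_g: "isCont g x" for x
    using g by (simp add: continuous_on_eq_continuous_at)
  have "continuous (at z within sphere 0 1) f" if z: "z \<in> sphere 0 1" for z
  proof (cases "z \<in> \<real>\<^sub>\<le>\<^sub>0")
    case False
    then have "isCont (\<lambda>z. g (Arg z)) z"
      using isCont_o2[OF continuous_at_Arg isCont_g] by blast
    then show ?thesis
      unfolding f_def by (rule continuous_at_imp_continuous_at_within)
  next
    case True
    then have "z \<notin> \<real>\<^sub>\<ge>\<^sub>0"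
      using z by (auto simp: complex_nonpos_Reals_iff complex_nonneg_Reals_iff cmod_eq_Re)
    then have "isCont (\<lambda>z. g (Arg2pi z)) z"
      using isCont_o2[OF continuous_at_Arg2pi isCont_g] by blast
    then have "continuous (at z within sphere 0 1) (\<lambda>z. g (Arg2pi z))"
      by (rule continuous_at_imp_continuous_at_within)
    then show ?thesis
      by (rule continuous_transform_within[OF _ zero_less_one]) (use z Arg2pi in auto)
  qed
  then have "continuous_on (sphere 0 1) f"
    by (simp add: continuous_on_eq_continuous_within)
  then show thesis
    using cis by (rule that)
qed

text \<open>Stone-Weierstrass gives polynomials p on the circle uniformly close to \<open>g\<close>.
  As \<open>g\<close> is orthogonal to p, the integral of g^2 equals that of g (g - p) and is
  arbitrarily small.\<close>

lemma periodic_orthogonal_to_modes_eq_0: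
  fixes g :: "real \<Rightarrow> real"
  assumes orth: "orthogonal_to_modes T (\<lambda>u. of_real (g u))" and per: "\<And>x. g (x + T) = g x" and "T > 0"
    and g: "continuous_on UNIV g"
  shows "g x = 0"
proof -
  define w where "w = 2 * pi / T"
  have w: "w > 0"
    using \<open>T > 0\<close> by (simp add: w_def)
  have "continuous_on UNIV (\<lambda>x. g (x / w))"
    by (rule continuous_on_compose2[OF g]) (use w in \<open>auto intro!: continuous_intros\<close>)
  moreover have "g ((x + 2 * pi) / w) = g (x / w)" for x
    using per[of "x / w"] \<open>T > 0\<close> by (simp add: w_def field_simps)
  ultimately obtain f :: "complex \<Rightarrow> real" where f: "continuous_on (sphere 0 1) f" "\<And>x. f (cis x) = g (x / w)"
    using continuous_on_circle_of_periodic[of "\<lambda>x. g (x / w)"] by blast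
  have fg: "f (cis (w * u)) = g u" for u
    using f(2)[of "w * u"] w by simp
  have gT: "continuous_on {0..T} g"
    using g continuous_on_subset by blast
  have "compact (g ` {0..T})"
    using gT by (intro compact_continuous_image) auto
  then obtain M where M: "\<And>u. u \<in> {0..T} \<Longrightarrow> \<bar>g u\<bar> \<le> M"
    using compact_imp_bounded bounded_iff by (metis imageI real_norm_def)
  have int: "(\<lambda>u. g u * g u) integrable_on {0..T}"
    by (intro integrable_continuous_real continuous_intros gT)
  have small: "\<bar>integral {0..T} (\<lambda>u. g u * g u)\<bar> \<le> M * T * e" if "e > 0" for e
  proof -
    obtain p where p: "real_polynomial_function p" "\<And>z. z \<in> sphere 0 1 \<Longrightarrow> \<bar>f z - p z\<bar> < e"
      using Stone_Weierstrass_real_polynomial_function[OF compact_sphere f(1) \<open>e > 0\<close>] by blast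
    have "((\<lambda>u. complex_of_real (g u) * of_real (p (cis (w * u)))) has_integral 0) {0..T}"
      using orthogonal_to_modes_polynomial[OF p(1) orth] unfolding orthogonal_to_modes_def w_def
      by (elim conjE allE[of _ 0]) simp
    then have "((\<lambda>u. Re (complex_of_real (g u) * of_real (p (cis (w * u))))) has_integral Re 0) {0..T}"
      by (rule has_integral_Re)
    then have "((\<lambda>u. g u * g u - g u * p (cis (w * u))) has_integral (integral {0..T} (\<lambda>u. g u * g u) - 0)) {0..T}"
      using int by (intro has_integral_diff integrable_integral) simp_all
    moreover have "norm (g u * g u - g u * p (cis (w * u))) \<le> M * e" if "u \<in> {0..T}" for u
    proof -
      have "norm (g u * g u - g u * p (cis (w * u))) = \<bar>g u\<bar> * \<bar>f (cis (w * u)) - p (cis (w * u))\<bar>"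
        by (simp only: fg real_norm_def abs_mult[symmetric] right_diff_distrib)
      also have "\<dots> \<le> M * e"
        using M[OF that] p(2)[of "cis (w * u)"] by (intro mult_mono) auto
      finally show ?thesis .
    qed
    moreover have "0 \<le> M"
      using M[of 0] \<open>T > 0\<close> by force
    ultimately have "norm (integral {0..T} (\<lambda>u. g u * g u) - 0) \<le> M * e * measure lborel {0..T}"
      using \<open>e > 0\<close> by (intro has_integral_bound_real) auto
    then show ?thesis
      using \<open>T > 0\<close> by (simp add: mult_ac)
  qed
  have "integral {0..T} (\<lambda>u. g u * g u) = 0"
  proof (rule ccontr)
    let ?I = "integral {0..T} (\<lambda>u. g u * g u)"
    assume "?I \<noteq> 0"
    moreover have "0 \<le> M"
      using M[of 0] \<open>T > 0\<close> by force
    then have MT: "0 < M * T + 1"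
      using \<open>T > 0\<close> by (simp add: add_nonneg_pos)
    \<comment> \<open>With this e the bound reads |I| \<le> |I| MT/(MT + 1), which is impossible for
      I \<noteq> 0.\<close>
    ultimately have "\<bar>?I\<bar> \<le> M * T * (\<bar>?I\<bar> / (M * T + 1))"
      by (intro small) simp
    then show False
      using \<open>?I \<noteq> 0\<close> MT by (simp add: field_simps)
  qed
  moreover have "continuous_on {0..T} (\<lambda>u. g u * g u)"
    by (intro continuous_intros gT)
  ultimately have zero: "g u = 0" if "u \<in> {0..T}" for u
    using integral_eq_0_iff[of 0 T "\<lambda>u. g u * g u"] that \<open>T > 0\<close> by simp
  define n where "n = \<lfloor>x / T\<rfloor>"
  have "of_int n \<le> x / T" "x / T \<le> of_int n + 1"
    unfolding n_def by linarith+
  then have "x + of_int (- n) * T \<in> {0..T}"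
    using \<open>T > 0\<close> by (simp add: field_simps)
  moreover have "g x = g (x + of_int (- n) * T)"
    using quasiperiodic_int[of g T 0 x "- n"] per by simp
  ultimately show ?thesis
    using zero by metis
qed

section \<open>The resonant deformation\<close>

text \<open>By \<open>resonance\<close>, sin (k u) has period \<open>a\<close>, so
  \<open>X s\<close> still gains 1 over the period \<open>a\<close>. The equation J_1(k) = 0 enters
  in \<open>zoll_field\<close>, and there for \<open>s \<noteq> 0\<close>; with
  \<open>k = 2 * pi / a\<close> the same locale therefore provides the constant field.\<close>

locale sinusoidal_family =
  fixes a k :: real and n :: nat
  assumes a_pos: "a > 0" and k_pos: "k > 0" and resonance: "k * a = 2 * pi * real n"
begin

definition X :: "real \<Rightarrow> real \<Rightarrow> real" where
  "X s u = u / a + s / k * sin (k * u)"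

definition X' :: "real \<Rightarrow> real \<Rightarrow> real" where
  "X' s u = 1 / a + s * cos (k * u)"

definition B :: "real \<Rightarrow> real \<Rightarrow> real" where
  "B s = inv (X s)"

definition profile :: "real \<Rightarrow> real \<Rightarrow> real" where
  "profile s x = inverse (X' s (B s x))"

text \<open>A function of cosets has to choose a representative; \<open>profile_shift\<close> makes
  the value independent of it once |s| < 1/a.\<close>

definition field :: "real \<Rightarrow> real \<Rightarrow> complex set \<Rightarrow> real" where
  "field L s q = profile s (Re (SOME z. q = torus_proj L z))"

lemma X_deriv: "(X s has_real_derivative X' s u) (at u)"
proof -
  have "((\<lambda>u. sin (k * u)) has_real_derivative cos (k * u) * k) (at u)"
    by (auto intro!: derivative_eq_intros)
  from DERIV_add[OF DERIV_cdivide[OF DERIV_ident] DERIV_cmult[OF this]]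
  have "((\<lambda>u. u / a + s / k * sin (k * u)) has_real_derivative 1 / a + s / k * (cos (k * u) * k)) (at u)" .
  then show ?thesis
    using k_pos by (simp add: X_def[abs_def] X'_def)
qed

lemma X'_ge: "X' s u \<ge> 1 / a - \<bar>s\<bar>"
proof -
  have "\<bar>s * cos (k * u)\<bar> \<le> \<bar>s\<bar>"
    by (simp add: abs_mult mult_left_le)
  then show ?thesis
    by (simp add: X'_def)
qed

lemma resonance_shift: "k * (u + a) = k * u + 2 * pi * real n"
  using resonance by (simp add: algebra_simps)

lemma cos_shift: "cos (k * (u + a)) = cos (k * u)" and sin_shift: "sin (k * (u + a)) = sin (k * u)"
proof -
  have "cos (x + real n * (2 * pi)) = cos x" "sin (x + real n * (2 * pi)) = sin x" for x :: real
    using quasiperiodic_nat[of "\<lambda>x. cos x" "2 * pi" 0 x n] quasiperiodic_nat[of "\<lambda>x. sin x" "2 * pi" 0 x n]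
    by simp_all
  then show "cos (k * (u + a)) = cos (k * u)" "sin (k * (u + a)) = sin (k * u)"
    unfolding resonance_shift mult.commute[of "2 * pi"] by blast+
qed

lemma X_shift: "X s (u + a) = X s u + 1"
  using a_pos by (simp add: X_def sin_shift add_divide_distrib)

lemma smooth_X': "smooth_on UNIV (X' s)"
  unfolding X'_def
  by (intro smooth_on_add smooth_on_mult smooth_on_const smooth_on_real_compose[OF smooth_on_cos]
      smooth_on_bounded_linear[OF bounded_linear_mult_right])

context
  fixes s :: real
  assumes s: "\<bar>s\<bar> < 1 / a"
begin

lemma X'_pos: "X' s u > 0"
  using X'_ge[of s u] s by linarith

lemma X_B: "X s (B s x) = x" and B_X: "B s (X s u) = u"
  and B_deriv: "(B s has_real_derivative inverse (X' s (B s x))) (at x)"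
  and B_shift: "B s (x + 1) = B s x + a"
proof -
  obtain g where g: "\<And>u. g (X s u) = u" "\<And>x. X s (g x) = x"
    "\<And>x. (g has_real_derivative inverse (X' s (g x))) (at x)" "\<And>x. g (x + 1) = g x + a"
    using quasiperiodic_inverse[OF X_deriv X'_pos X_shift a_pos] by blast
  then have "B s = g"
    unfolding B_def by (intro inv_equality)
  then show "X s (B s x) = x" "B s (X s u) = u" "B s (x + 1) = B s x + a"
    "(B s has_real_derivative inverse (X' s (B s x))) (at x)"
    using g by simp_all
qed

lemma profile_shift: "profile s (x + 1) = profile s x"
  by (simp add: profile_def B_shift X'_def cos_shift)

lemma field_torus_proj: "field L s (torus_proj L z) = profile s (Re z)"
proof -
  define w where "w = (SOME w. torus_proj L z = torus_proj L w)"
  have "torus_proj L z = torus_proj L w"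
    unfolding w_def by (rule someI[of _ z]) simp
  then obtain m where "Re z = Re w + of_int m * 1"
    by (auto simp: torus_proj_eq_iff)
  then have "profile s (Re z) = profile s (Re w)"
    using quasiperiodic_int[of "profile s" 1 0 "Re w" m] profile_shift by simp
  then show ?thesis
    by (simp add: field_def w_def)
qed

lemma smooth_B: "smooth_on UNIV (B s)"
proof (rule smooth_on_autonomous[OF B_deriv])
  show "smooth_on UNIV (\<lambda>u. inverse (X' s u))"
    using X'_pos by (intro smooth_on_inverse smooth_X') (simp add: less_imp_neq[symmetric])
qed

lemma smooth_profile: "smooth_on UNIV (profile s)"
  unfolding profile_def using X'_pos
  by (intro smooth_on_inverse smooth_on_real_compose[OF smooth_X' smooth_B])
     (simp add: less_imp_neq[symmetric])

lemma profile_pos: "profile s x > 0"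
  by (simp add: profile_def X'_pos)

lemma magnetic_function_field: "magnetic_function L (field L s)"
  unfolding magnetic_function_def field_torus_proj
  by (intro smooth_on_real_compose[OF smooth_profile] smooth_on_bounded_linear bounded_linear_Re)

lemma depends_only_on_x_field: "depends_only_on_x L (field L s)"
  by (simp add: depends_only_on_x_def field_torus_proj)

lemma torus_average_field:
  assumes "L > 0"
  shows "torus_average L (field L s) = a"
proof -
  have "continuous_on UNIV (profile s)"
    using smooth_profile Ck_on.simps(1) unfolding smooth_on_def by blast
  then have "torus_average L (field L s) = integral {0..1} (profile s)"
    using assms field_torus_proj by (intro torus_average_eq)
  also have "(profile s has_integral B s 1 - B s 0) {0..1}"
    unfolding profile_def by (intro has_integral_of_primitive B_deriv) simp
  then have "integral {0..1} (profile s) = a"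
    using B_shift[of 0] by (simp add: integral_unique)
  finally show ?thesis .
qed

text \<open>The addition theorem splits the displacement over a turn into three terms: sin \<phi> /
  a integrates to 0, \<open>p\<close> does so because it changes sign under \<phi> + pi, and the
  term with \<open>q\<close> is a multiple of s J_1(k).\<close>

lemma zoll_field:
  assumes "s = 0 \<or> bessel_J 1 k = 0"
  shows "zoll L (field L s)"
proof -
  define p q where "p x = sin x * cos (k * sin x)" and "q x = sin x * sin (k * sin x)" for x
  have smooth: "smooth_on UNIV p" "smooth_on UNIV q"
    unfolding p_def q_def
    by (intro smooth_on_mult smooth_on_sin smooth_on_real_compose[OF smooth_on_cos]
        smooth_on_real_compose[OF smooth_on_sin] smooth_on_const)+
  have cont: "continuous_on UNIV p" "continuous_on UNIV q"
    unfolding p_def q_def by (intro continuous_intros)+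
  obtain P where P: "P 0 = 0" "\<And>x. (P has_real_derivative p x) (at x)"
    using real_primitive[OF cont(1)] by blast
  obtain Q where Q: "Q 0 = 0" "\<And>x. (Q has_real_derivative q x) (at x)"
    using real_primitive[OF cont(2)] by blast
  have smoothPQ: "smooth_on UNIV P" "smooth_on UNIV Q"
    using P(2) Q(2) smooth by (auto intro: smooth_on_real_primitive)
  \<comment> \<open>Since p(x + pi) = -p(x), the sum P(x + pi) + P(x) is constant; comparing it at x
    and at x + pi gives the period 2 pi of \<open>P\<close>.\<close>
  have "((\<lambda>x. P (x + pi) + P x) has_real_derivative 0) (at x)" for x
    using DERIV_shift[THEN iffD1, OF P(2)[of "x + pi"]] P(2)[of x]
    by (auto intro!: derivative_eq_intros simp: p_def)
  then have "P (x + pi) + P x = P (0 + pi) + P 0" for x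
    using DERIV_isconst_all[of "\<lambda>x. P (x + pi) + P x"] by blast
  from this[of "x + pi" for x] this have P_per: "P (x + 2 * pi) = P x" for x
    by (simp add: add.assoc) (smt (verit))
  have "(q has_integral Q (2 * pi) - Q 0) {0..2 * pi}"
    by (intro has_integral_of_primitive Q) simp
  then have "Q (2 * pi) - Q 0 = 2 * pi * bessel_J 1 k"
    using bessel_J1_integral[of k] has_integral_unique unfolding q_def by blast
  moreover have "Q (x + 2 * pi) = Q x + (Q (2 * pi) - Q 0)" for x
    by (rule primitive_of_periodic[OF Q(2)]) (simp add: q_def)
  ultimately have Q_per: "s * Q (x + 2 * pi) = s * Q x" for x
    using assms by auto
  \<comment> \<open>Sums of products of a function of K and one of \<phi>: in this form the period
    in K and joint smoothness are immediate.\<close>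
  define Y where "Y K \<phi> = s * (cos (k * K) * P \<phi>) - sin (k * K) * (s * Q \<phi>) - cos \<phi> / a" for K \<phi>
  show ?thesis
  proof (rule zoll_of_closed_orbits[where Y = Y, OF magnetic_function_field depends_only_on_x_field
        X_deriv X'_pos smooth_X' smooth_B X_B B_X X_shift])
    show "field L s (torus_proj L z) = inverse (X' s (B s (Re z)))" for z
      by (simp add: field_torus_proj profile_def)
    show "(Y K has_real_derivative sin \<phi> * X' s (K + sin \<phi>)) (at \<phi>)" for K \<phi>
    proof -
      have "(Y K has_real_derivative s * (cos (k * K) * p \<phi>) - sin (k * K) * (s * q \<phi>) - (- sin \<phi>) / a) (at \<phi>)"
        unfolding Y_def by (intro DERIV_diff DERIV_cmult P Q DERIV_cdivide DERIV_cos)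
      moreover have "cos (k * (K + sin \<phi>)) = cos (k * K) * cos (k * sin \<phi>) - sin (k * K) * sin (k * sin \<phi>)"
        by (simp add: ring_distribs cos_add)
      then have "s * (cos (k * K) * p \<phi>) - sin (k * K) * (s * q \<phi>) - (- sin \<phi>) / a = sin \<phi> * X' s (K + sin \<phi>)"
        unfolding X'_def p_def q_def by (simp only:) (simp add: algebra_simps)
      ultimately show ?thesis
        by simp
    qed
    show "Y (K + a) \<phi> = Y K \<phi>" for K \<phi>
      by (simp add: Y_def cos_shift sin_shift)
    show "Y K (\<phi> + 2 * pi) = Y K \<phi>" for K \<phi>
      by (simp add: Y_def P_per Q_per)
    show "smooth_on UNIV (\<lambda>w. Y (f w) (g w))"
      if "smooth_on UNIV f" "smooth_on UNIV g" for f g :: "real \<times> complex \<times> real \<Rightarrow> real"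
      unfolding Y_def divide_inverse
      by (intro smooth_on_diff smooth_on_mult smooth_on_const that smooth_on_real_compose[OF smooth_on_cos]
        smooth_on_real_compose[OF smooth_on_sin] smooth_on_real_compose[OF smoothPQ(1)] smooth_on_real_compose[OF smoothPQ(2)])
  qed
qed

text \<open>Solving \<open>X s (B s x) = x\<close> for its linear term gives an equation of Kepler
  type, whose perturbation is bounded by a |s| / k. It shows that \<open>B s x\<close> is continuous
  in s at 0.\<close>

lemma B_minus_linear: "\<bar>B s x - a * x\<bar> \<le> a / k * \<bar>s\<bar>"
proof -
  have "B s x - a * x = - (a / k * s * sin (k * B s x))"
    using X_B[of x] a_pos k_pos by (simp add: X_def field_simps)
  then have "\<bar>B s x - a * x\<bar> = a / k * \<bar>s\<bar> * \<bar>sin (k * B s x)\<bar>"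
    using a_pos k_pos by (simp add: abs_mult)
  also have "\<dots> \<le> a / k * \<bar>s\<bar>"
    using a_pos k_pos by (intro mult_left_le) auto
  finally show ?thesis .
qed

text \<open>An exact identity instead of an expansion: after division by \<open>s\<close>, the
  derivative at s = 0 reduces to the limit of \<open>B s x\<close>.\<close>

lemma profile_minus_const: "profile s x - a = s * (- a * cos (k * B s x) * profile s x)"
  using X'_pos[of "B s x"] a_pos by (simp add: profile_def X'_def field_simps)

text \<open>The real supremum dominates the values of a bounded family; the bound comes from
  \<open>X'_ge\<close>, and every \<open>u\<close> occurs as some \<open>B s x\<close>.\<close>

lemma SUP_field_ge:
  "inverse (X' s u) \<le> (SUP q\<in>torus L. field L s q)"
proof -
  have "inverse (X' s u) = field L s (torus_proj L (of_real (X s u)))"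
    by (simp add: field_torus_proj profile_def B_X)
  moreover have "bdd_above (field L s ` torus L)"
    using X'_ge[of s] s
    by (intro bdd_aboveI2[of _ _ "inverse (1 / a - \<bar>s\<bar>)"])
       (auto simp: torus_def field_torus_proj profile_def intro!: le_imp_inverse_le)
  ultimately show ?thesis
    by (simp add: torus_def cSUP_upper)
qed

end

section \<open>Derivative of the family at s = 0 and blow-up at the ends\<close>

lemma field_0: "field L 0 (torus_proj L z) = a"
  using field_torus_proj[of 0] a_pos by (simp add: profile_def X'_def)

lemma field_deriv:
  "((\<lambda>s. field L s (torus_proj L z)) has_real_derivative - a\<^sup>2 * cos (k * (a * Re z))) (at 0)"
proof -
  let ?x = "Re z"
  have small: "eventually (\<lambda>s. \<bar>s\<bar> < 1 / a \<and> s \<noteq> 0) (at 0)"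
    using a_pos by (auto simp: eventually_at intro!: exI[of _ "1 / a"])
  have "((\<lambda>s. B s ?x - a * ?x) \<longlongrightarrow> 0) (at 0)"
  proof (rule Lim_null_comparison)
    show "eventually (\<lambda>s. norm (B s ?x - a * ?x) \<le> a / k * \<bar>s\<bar>) (at 0)"
      using small by eventually_elim (metis B_minus_linear real_norm_def)
    show "((\<lambda>s. a / k * \<bar>s\<bar>) \<longlongrightarrow> 0) (at 0)"
      using k_pos by (auto intro!: tendsto_eq_intros)
  qed
  then have B: "((\<lambda>s. B s ?x) \<longlongrightarrow> a * ?x) (at 0)"
    by (simp add: LIM_zero_iff)
  have "((\<lambda>s. - a * cos (k * B s ?x) * inverse (1 / a + s * cos (k * B s ?x))) \<longlongrightarrow>
      - a * cos (k * (a * ?x)) * inverse (1 / a + 0 * cos (k * (a * ?x)))) (at 0)"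
    using a_pos by (intro tendsto_intros B) auto
  then have "((\<lambda>s. - a * cos (k * B s ?x) * profile s ?x) \<longlongrightarrow> - a\<^sup>2 * cos (k * (a * ?x))) (at 0)"
    by (simp add: profile_def X'_def power2_eq_square mult_ac)
  then have "((\<lambda>s. (field L (0 + s) (torus_proj L z) - field L 0 (torus_proj L z)) / s)
      \<longlongrightarrow> - a\<^sup>2 * cos (k * (a * ?x))) (at 0)"
    by (rule Lim_transform_eventually)
       (use small in eventually_elim, simp add: field_torus_proj field_0 profile_minus_const)
  then show ?thesis
    by (simp add: DERIV_def)
qed

lemma SUP_field_at_left: "filterlim (\<lambda>s. SUP q\<in>torus L. field L s q) at_top (at_left (1 / a))"
proof (rule filterlim_at_top_mono)
  show "filterlim (\<lambda>s. inverse (1 / a - s)) at_top (at_left (1 / a))"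
    by (rule filterlim_inverse_at_top)
       (auto intro!: tendsto_eq_intros simp: eventually_at_filter)
  have "eventually (\<lambda>s. s \<in> {- (1 / a)<..<1 / a}) (at_left (1 / a))"
    using a_pos by (intro eventually_at_left_real) simp
  then show "eventually (\<lambda>s. inverse (1 / a - s) \<le> (SUP q\<in>torus L. field L s q)) (at_left (1 / a))"
  proof eventually_elim
    case (elim s)
    \<comment> \<open>For s near 1/a the field is largest where the cosine is -1; at the other end
      it is largest where the cosine is 1.\<close>
    have "X' s (pi / k) = 1 / a - s"
      using k_pos by (simp add: X'_def)
    then show ?case
      using SUP_field_ge[of s "pi / k" L] elim by (simp add: abs_less_iff)
  qed
qed

lemma SUP_field_at_right: "filterlim (\<lambda>s. SUP q\<in>torus L. field L s q) at_top (at_right (- (1 / a)))"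
proof (rule filterlim_at_top_mono)
  show "filterlim (\<lambda>s. inverse (1 / a + s)) at_top (at_right (- (1 / a)))"
    by (rule filterlim_inverse_at_top)
       (auto intro!: tendsto_eq_intros simp: eventually_at_filter)
  have "eventually (\<lambda>s. s \<in> {- (1 / a)<..<1 / a}) (at_right (- (1 / a)))"
    using a_pos by (intro eventually_at_right_real) simp
  then show "eventually (\<lambda>s. inverse (1 / a + s) \<le> (SUP q\<in>torus L. field L s q)) (at_right (- (1 / a)))"
  proof eventually_elim
    case (elim s)
    have "X' s 0 = 1 / a + s"
      by (simp add: X'_def)
    then show ?case
      using SUP_field_ge[of s 0 L] elim by (simp add: abs_less_iff)
  qed
qed

end

lemma resonant_zoll_family:
  assumes "L > 0" "bcon > 0" "bcon \<in> resonant_set"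
  shows "\<exists>b :: real \<Rightarrow> complex set \<Rightarrow> real.
         (\<forall>q\<in>torus L. b 0 q = bcon) \<and>
         (\<forall>s\<in>{- (1 / bcon)<..<1 / bcon}.
            magnetic_function L (b s) \<and> (\<forall>q\<in>torus L. b s q > 0) \<and> depends_only_on_x L (b s) \<and>
            torus_average L (b s) = bcon \<and> zoll L (b s)) \<and>
         (\<exists>b'. (\<forall>q\<in>torus L. ((\<lambda>s. b s q) has_real_derivative b' q) (at 0)) \<and>
               (\<exists>q\<in>torus L. b' q \<noteq> 0)) \<and>
         filterlim (\<lambda>s. SUP q\<in>torus L. b s q) at_top (at_left (1 / bcon)) \<and>
         filterlim (\<lambda>s. SUP q\<in>torus L. b s q) at_top (at_right (- (1 / bcon)))"
proof -
  obtain n \<xi> where \<xi>: "bcon = 2 * pi * real n / \<xi>" "\<xi> > 0" "bessel_J 1 \<xi> = 0"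
    using assms(3) by (auto simp: resonant_set_def)
  interpret sinusoidal_family bcon \<xi> n
    by unfold_locales (use \<xi> assms(2) in \<open>simp_all add: field_simps\<close>)
  have s: "\<bar>s\<bar> < 1 / bcon" if "s \<in> {- (1 / bcon)<..<1 / bcon}" for s
    using that by (auto simp: abs_less_iff)
  have "\<exists>d. ((\<lambda>s. field L s q) has_real_derivative d) (at 0)" if "q \<in> torus L" for q
    using that field_deriv by (auto simp: torus_def)
  then obtain b' where b': "\<And>q. q \<in> torus L \<Longrightarrow> ((\<lambda>s. field L s q) has_real_derivative b' q) (at 0)"
    by metis
  have "b' (torus_proj L 0) = - bcon\<^sup>2 * cos (\<xi> * (bcon * Re 0))"
    using b'[of "torus_proj L 0"] field_deriv[of L 0] by (intro DERIV_unique) (auto simp: torus_def)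
  then have "b' (torus_proj L 0) \<noteq> 0"
    using assms(2) by simp
  then have "\<exists>q\<in>torus L. b' q \<noteq> 0"
    by (auto simp: torus_def)
  moreover have "field L s q > 0" if "s \<in> {- (1 / bcon)<..<1 / bcon}" "q \<in> torus L" for s q
    using that s[OF that(1)] by (auto simp: torus_def field_torus_proj profile_pos)
  moreover have "\<forall>q\<in>torus L. field L 0 q = bcon"
    by (auto simp: torus_def field_0)
  ultimately show ?thesis
    using s b' magnetic_function_field depends_only_on_x_field torus_average_field[OF _ assms(1)]
      zoll_field \<xi>(3) SUP_field_at_left SUP_field_at_right
    by (intro exI[of _ "field L"] conjI ballI exI[of _ b']) auto
qed

text \<open>\<open>b\<close> and the member s = 0 of the family may differ outside
  \<open>torus L\<close>, but geodesics see only values on the torus, so the flows coincide. The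
  wave number \<open>2 * pi / a\<close> is one that satisfies \<open>resonance\<close>.\<close>

lemma zoll_constant:
  assumes "a > 0" and "\<And>q. q \<in> torus L \<Longrightarrow> b q = a"
  shows "zoll L b"
proof -
  interpret sinusoidal_family a "2 * pi / a" 1
    by unfold_locales (use assms(1) in simp_all)
  have b: "b (torus_proj L z) = a" for z
    using assms(2) by (simp add: torus_def)
  have "magnetic_geodesic L b = magnetic_geodesic L (field L 0)"
    by (intro ext) (simp add: magnetic_geodesic_def field_0 b)
  then have "magnetic_flow L b = magnetic_flow L (field L 0)"
    by (intro ext) (simp add: magnetic_flow_def)
  moreover have "zoll L (field L 0)"
    using assms(1) by (intro zoll_field) simp_all
  ultimately show ?thesis
    by (simp add: zoll_def)
qed

section \<open>Rigidity in the nonresonant case\<close>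

text \<open>Supplies both the first zero of \<beta> to the right of a point and the first time at
  which a geodesic turns vertical.\<close>

lemma first_zero:
  fixes f :: "real \<Rightarrow> real"
  assumes "continuous_on UNIV f" "f a > 0" "a \<le> b" "f b \<le> 0"
  obtains z where "a < z" "z \<le> b" "f z = 0" "\<And>x. a \<le> x \<Longrightarrow> x < z \<Longrightarrow> f x > 0"
proof -
  define Z where "Z = {x. a \<le> x \<and> f x = 0}"
  have cont: "continuous_on {c..d} f" for c d
    using assms(1) continuous_on_subset by blast
  have zero: "\<exists>z\<in>Z. z \<le> x" if "a \<le> x" "f x \<le> 0" for x
    using IVT2'[of f x 0 a] that assms(2) cont by (auto simp: Z_def)
  have "closed Z"
    unfolding Z_def using assms(1)
    by (intro closed_Collect_conj closed_Collect_le closed_Collect_eq) (auto intro: continuous_intros)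
  moreover have "Z \<noteq> {}"
    using zero assms by blast
  moreover have bdd: "bdd_below Z"
    by (auto simp: Z_def intro: bdd_belowI)
  ultimately have Inf: "Inf Z \<in> Z"
    by (intro closed_contains_Inf)
  have lower: "Inf Z \<le> z" if "z \<in> Z" for z
    using that bdd by (rule cInf_lower)
  have "a \<noteq> Inf Z"
    using Inf assms(2) by (auto simp: Z_def)
  then have "a < Inf Z" "f (Inf Z) = 0"
    using Inf by (auto simp: Z_def)
  moreover have "Inf Z \<le> b"
    using zero[OF assms(3,4)] lower by force
  moreover have "f x > 0" if x: "a \<le> x" "x < Inf Z" for x
  proof (rule ccontr)
    assume "\<not> f x > 0"
    then obtain z where "z \<in> Z" "z \<le> x"
      using zero[OF x(1)] by (auto simp: not_less)
    then show False
      using lower[of z] x(2) by simp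
  qed
  ultimately show thesis
    by (intro that)
qed

section \<open>Closed orbits, geodesics and the sign of the field in a Zoll system\<close>

lemma zoll_closed_orbit:
  assumes "zoll L b" "p \<in> unit_tangent_bundle L"
  obtains t where "t > 0" "magnetic_flow L b t p = p"
proof -
  obtain A h where A: "smooth_free_circle_action L A" "strict_mono (h :: real \<Rightarrow> real)" "h 0 = 0"
    "\<And>\<tau>. A (cis \<tau>) p = magnetic_flow L b (h \<tau>) p"
    using assms unfolding zoll_def by blast
  have "A 1 p = p"
    using A(1) assms(2) by (simp add: smooth_free_circle_action_def)
  then have "magnetic_flow L b (h (2 * pi)) p = p"
    using A(4)[of "2 * pi"] by simp
  moreover have "h (2 * pi) > 0"
    using strict_monoD[OF A(2), of 0 "2 * pi"] A(3) by simp
  ultimately show thesis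
    by (intro that)
qed

text \<open>
  No solution theory is needed to produce geodesics of a Zoll system: without a geodesic through \<open>p\<close>
  the flow at \<open>p\<close> would be \<open>THE q. False\<close> at all times, and the action would fix \<open>p\<close>.
\<close>
lemma zoll_geodesic:
  assumes "zoll L b" "p \<in> unit_tangent_bundle L"
  obtains c v where "magnetic_geodesic L b c v" "(torus_proj L (c 0), v 0) = p"
proof (rule ccontr)
  assume "\<not> thesis"
  then have "magnetic_flow L b t p = (THE q. False)" for t
    unfolding magnetic_flow_def using that by (intro arg_cong[of _ _ The]) blast
  then have const: "magnetic_flow L b t p = magnetic_flow L b t' p" for t t'
    by simp
  obtain A and h :: "real \<Rightarrow> real" where A: "smooth_free_circle_action L A"
    "\<And>\<tau>. A (cis \<tau>) p = magnetic_flow L b (h \<tau>) p"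
    using assms unfolding zoll_def by blast
  have "A (cis pi) p = A (cis 0) p"
    unfolding A(2) by (rule const)
  then have "A (- 1) p = p"
    using A(1) assms(2) by (simp add: smooth_free_circle_action_def)
  moreover have "- 1 \<in> sphere (0::complex) 1"
    by simp
  ultimately have "- 1 = (1::complex)"
    using A(1) assms(2) unfolding smooth_free_circle_action_def by blast
  then show False
    by simp
qed

text \<open>Both terms have derivative \<beta> Re v: the first because the field rotates v, the
  second by the chain rule.\<close>

lemma magnetic_geodesic_energy:
  assumes "magnetic_geodesic L b c v" "\<And>z. b (torus_proj L z) = \<beta> (Re z)"
    and "\<And>x. (B has_real_derivative \<beta> x) (at x)"
  shows "Im (v t) - B (Re (c t)) = Im (v 0) - B (Re (c 0))"
proof -
  have "((\<lambda>t. Im (v t) - B (Re (c t))) has_real_derivative 0) (at t)" for t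
  proof -
    have "(c has_vector_derivative v t) (at t)"
      "(v has_vector_derivative of_real (\<beta> (Re (c t))) * (\<i> * v t)) (at t)"
      using assms(1,2) by (simp_all add: magnetic_geodesic_def)
    then have "((\<lambda>t. Re (c t)) has_real_derivative Re (v t)) (at t)"
      "((\<lambda>t. Im (v t)) has_real_derivative \<beta> (Re (c t)) * Re (v t)) (at t)"
      by (auto dest: has_field_derivative_Re has_field_derivative_Im)
    from DERIV_diff[OF this(2) DERIV_chain2[OF assms(3) this(1)]] show ?thesis
      by simp
  qed
  then show ?thesis
    using DERIV_isconst_all[of "\<lambda>t. Im (v t) - B (Re (c t))"] by blast
qed

text \<open>
  At a zero of \<open>\<beta>\<close> the vertical line is a geodesic. The geodesics of the same energy in the region where
  \<open>\<beta> > 0\<close> next to it move towards this line forever, so they do not close up.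
\<close>
lemma zoll_magnetic_pos:
  assumes "L > 0" and b: "magnetic_function L b" "depends_only_on_x L b"
    and zoll: "zoll L b" and avg: "torus_average L b > 0"
  shows "b (torus_proj L z) > 0"
proof -
  obtain \<beta> M where \<beta>: "\<And>z. b (torus_proj L z) = \<beta> (Re z)" and cont: "continuous_on UNIV \<beta>"
    and per: "\<And>x. \<beta> (x + 1) = \<beta> x" and lip: "\<And>x y. \<bar>\<beta> x - \<beta> y\<bar> \<le> M * \<bar>x - y\<bar>"
    using magnetic_profile[OF b] by metis
  obtain B where B: "\<And>x. (B has_real_derivative \<beta> x) (at x)"
    using real_primitive[OF cont] by blast
  have "\<exists>x1. \<beta> x1 > 0"
  proof (rule ccontr)
    assume "\<nexists>x1. \<beta> x1 > 0"
    moreover have "\<beta> integrable_on {0..1}"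
      by (intro integrable_continuous_real continuous_on_subset[OF cont]) simp
    ultimately have "integral {0..1} \<beta> \<le> integral {0..1} (\<lambda>_::real. 0::real)"
      by (intro integral_le) (auto simp: not_less)
    then show False
      using avg torus_average_eq[OF \<open>L > 0\<close> \<beta> cont] by simp
  qed
  then obtain x1 where x1: "\<beta> x1 > 0"
    by blast
  have "\<beta> x > 0" for x
  proof (rule ccontr)
    assume "\<not> \<beta> x > 0"
    \<comment> \<open>Periodicity moves the point with \<beta> \<le> 0 to the right of
      \<open>x1\<close>, so that there is a first zero \<open>x0\<close> with \<beta> > 0 between
      \<open>x1\<close> and it.\<close>
    define y where "y = x + of_int \<lceil>x1 - x\<rceil>"
    have "\<beta> y \<le> 0"
      using quasiperiodic_int[of \<beta> 1 0 x "\<lceil>x1 - x\<rceil>"] per \<open>\<not> \<beta> x > 0\<close> by (simp add: y_def)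
    moreover have "x1 \<le> y"
      unfolding y_def by linarith
    ultimately obtain x0 where x0: "x1 < x0" "\<beta> x0 = 0" and pos: "\<And>x. x1 \<le> x \<Longrightarrow> x < x0 \<Longrightarrow> \<beta> x > 0"
      using first_zero[OF cont x1, of y] by metis
    have contB: "continuous_on UNIV B"
      using B by (meson DERIV_isCont continuous_at_imp_continuous_on)
    have B_less: "B x < B y" if "x1 \<le> x" "x < y" "y \<le> x0" for x y
    proof (rule DERIV_pos_imp_increasing_open[OF \<open>x < y\<close>])
      show "\<exists>d. (B has_real_derivative d) (at u) \<and> 0 < d" if "x < u" "u < y" for u
        using B pos[of u] that \<open>x1 \<le> x\<close> \<open>y \<le> x0\<close> by (intro exI[of _ "\<beta> u"]) simp
      show "continuous_on {x..y} B"
        using contB continuous_on_subset by blast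
    qed
    have "isCont B x0"
      using B DERIV_isCont by blast
    then obtain d where d: "d > 0" "\<And>y. dist y x0 < d \<Longrightarrow> dist (B y) (B x0) < 2"
      unfolding continuous_at_eps_delta by (metis zero_less_numeral)
    define x2 where "x2 = max x1 (x0 - d / 2)"
    have x2: "x1 \<le> x2" "x2 < x0"
      using x0(1) d(1) by (auto simp: x2_def)
    have "dist x2 x0 < d"
      using x2 d(1) by (auto simp: dist_real_def x2_def)
    then have "B x0 - B x2 < 2"
      using d(2)[of x2] by (simp add: dist_real_def)
    \<comment> \<open>The initial sine for which the energy equals 1 - B x0, that of the upward
      vertical line at \<open>x0\<close>. It exceeds -1 because \<open>x2\<close> is so close to
      \<open>x0\<close> that B x0 - B x2 < 2.\<close>
    define S where "S = B x2 - B x0 + 1"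
    have S: "- 1 < S" "S < 1"
      using \<open>B x0 - B x2 < 2\<close> B_less[of x2 x0] x2 by (auto simp: S_def)
    have "(torus_proj L (of_real x2), cis (arcsin S)) \<in> unit_tangent_bundle L"
      by (simp add: unit_tangent_bundle_def torus_def)
    then obtain c v where geo: "magnetic_geodesic L b c v"
      and start: "(torus_proj L (c 0), v 0) = (torus_proj L (of_real x2), cis (arcsin S))"
      by (rule zoll_geodesic[OF zoll])
    obtain t where "t > 0" and "magnetic_flow L b t (torus_proj L (c 0), v 0) = (torus_proj L (c 0), v 0)"
      using zoll_closed_orbit[OF zoll] \<open>_ \<in> unit_tangent_bundle L\<close> start by metis
    then have "v t = v 0"
      using magnetic_flow_eq[OF b geo] by simp
    obtain m :: int where m: "Re (c 0) = x2 + of_int m"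
      using start by (auto simp: torus_proj_eq_iff)
    have \<beta>_int: "\<beta> (u + of_int m) = \<beta> u" for u
      using quasiperiodic_int[of \<beta> 1 0 u m] per by simp
    \<comment> \<open>The abscissa, normalised to start exactly at \<open>x2\<close>, although the
      lift \<open>c\<close> may start an integer away.\<close>
    define \<xi> where "\<xi> t = Re (c t) - of_int m" for t
    have c: "(c has_vector_derivative v t) (at t)" and v1: "norm (v t) = 1"
      and v: "(v has_vector_derivative of_real (\<beta> (Re (c t))) * (\<i> * v t)) (at t)" for t
      using geo \<beta> by (simp_all add: magnetic_geodesic_def)
    have \<xi>: "(\<xi> has_real_derivative Re (v t)) (at t)" for t
      using DERIV_diff[OF has_field_derivative_Re[OF c[of t]] DERIV_const] unfolding \<xi>_def by simp
    have \<xi>0: "\<xi> 0 = x2"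
      by (simp add: \<xi>_def m)
    have "((\<lambda>u. B (u - of_int m)) has_real_derivative \<beta> u) (at u)" for u
    proof -
      have "((\<lambda>u. u - of_int m) has_real_derivative 1) (at u)"
        by (auto intro!: derivative_eq_intros)
      from DERIV_chain2[OF B this] show ?thesis
        using \<beta>_int[of "u - of_int m"] by simp
    qed
    from magnetic_geodesic_energy[OF geo \<beta> this]
    have "Im (v t) - B (\<xi> t) = Im (v 0) - B (\<xi> 0)" for t
      by (simp add: \<xi>_def)
    moreover have v0: "Im (v 0) = S" "Re (v 0) > 0"
      using start S by (auto simp: cos_arcsin abs_square_less_1 abs_less_iff)
    ultimately have "Im (v t) - B (\<xi> t) = S - B x2" for t
      by (simp only: \<xi>0)
    then have energy: "Im (v t) = B (\<xi> t) - B x0 + 1" for t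
      by (simp add: S_def diff_eq_eq)
    have circle: "(Re (v t))\<^sup>2 + (Im (v t))\<^sup>2 = 1" for t
      using v1[of t] by (simp add: cmod_def)
    \<comment> \<open>On reaching \<open>x0\<close> the energy forces v = i, and uniqueness would
      make the whole geodesic the vertical line, against Re (v 0) > 0.\<close>
    have not_x0: "\<xi> t \<noteq> x0" for t
    proof
      assume t: "\<xi> t = x0"
      then have "v t = \<i>"
        using energy[of t] circle[of t] by (simp add: complex_eq_iff)
      have "\<beta> (Re (c t)) = 0"
        using t x0(2) \<beta>_int[of x0] by (simp add: \<xi>_def) (metis diff_add_cancel)
      have shift: "((\<lambda>\<tau>. f (t + \<tau>)) has_vector_derivative D) (at \<tau>)"
        if "(f has_vector_derivative D) (at (t + \<tau>))" for f :: "real \<Rightarrow> complex" and D \<tau>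
      proof -
        have "((\<lambda>\<tau>. t + \<tau>) has_real_derivative 1) (at \<tau>)"
          by (auto intro!: derivative_eq_intros)
        then have "((\<lambda>\<tau>. t + \<tau>) has_vector_derivative 1) (at \<tau>)"
          by (simp only: has_real_derivative_iff_has_vector_derivative)
        from vector_diff_chain_at[OF this that] show ?thesis
          by (simp add: o_def)
      qed
      have "c (t + (- t)) = c t + of_real (- t) * \<i> \<and> v (t + (- t)) = \<i>"
      proof (rule magnetic_ode_unique[OF lip, where ?c1.0 = "\<lambda>\<tau>. c (t + \<tau>)" and ?v1.0 = "\<lambda>\<tau>. v (t + \<tau>)"
            and ?c2.0 = "\<lambda>\<tau>. c t + of_real \<tau> * \<i>" and ?v2.0 = "\<lambda>_. \<i>"])
        show "((\<lambda>\<tau>. c (t + \<tau>)) has_vector_derivative v (t + \<tau>)) (at \<tau>)"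
          "((\<lambda>\<tau>. v (t + \<tau>)) has_vector_derivative of_real (\<beta> (Re (c (t + \<tau>)))) * (\<i> * v (t + \<tau>))) (at \<tau>)" for \<tau>
          by (intro shift c v)+
        show "((\<lambda>\<tau>. c t + of_real \<tau> * \<i>) has_vector_derivative \<i>) (at \<tau>)" for \<tau>
          by (auto intro!: derivative_eq_intros simp: has_vector_derivative_complex_iff)
      qed (use \<open>v t = \<i>\<close> \<open>\<beta> (Re (c t)) = 0\<close> in simp_all)
      then show False
        using v0(2) by simp
    qed
    have \<xi>_less: "\<xi> t < x0" if "t \<ge> 0" for t
    proof (rule ccontr)
      assume "\<not> \<xi> t < x0"
      then show False
        using IVT[of \<xi> 0 x0 t] that \<xi> \<xi>0 x2 not_x0 DERIV_isCont by (metis less_imp_le not_less)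
    qed
    have contv: "continuous_on UNIV (\<lambda>t. Re (v t))"
      using has_vector_derivative_continuous[OF v]
      by (intro continuous_at_imp_continuous_on ballI continuous_Re) auto
    have \<xi>_incr: "\<xi> 0 < \<xi> t" if "t > 0" "\<And>u. 0 \<le> u \<Longrightarrow> u < t \<Longrightarrow> Re (v u) > 0" for t
    proof (rule DERIV_pos_imp_increasing_open[OF that(1)])
      show "continuous_on {0..t} \<xi>"
        using \<xi> by (meson DERIV_isCont continuous_at_imp_continuous_on)
    qed (use \<xi> that(2) in \<open>auto intro: less_imp_le\<close>)
    \<comment> \<open>At a first vertical moment the abscissa lies strictly between
      \<open>x2\<close> and \<open>x0\<close>, so the energy keeps Im v strictly between -1 and 1,
      against unit speed.\<close>
    have Re_pos: "Re (v t) > 0" if t: "t \<ge> 0" for t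
    proof (rule ccontr)
      assume "\<not> Re (v t) > 0"
      then obtain u where u: "0 < u" "Re (v u) = 0" "\<And>r. 0 \<le> r \<Longrightarrow> r < u \<Longrightarrow> Re (v r) > 0"
        using first_zero[OF contv v0(2) t] by (metis not_less)
      have "x2 < \<xi> u" "\<xi> u < x0"
        using \<xi>_incr[OF u(1,3)] \<xi>0 \<xi>_less u(1) by auto
      then have "B x2 < B (\<xi> u)" "B (\<xi> u) < B x0"
        using B_less x2 by auto
      then have "- 1 < Im (v u)" "Im (v u) < 1"
        using energy[of u] S by (auto simp: S_def)
      then have "(Im (v u))\<^sup>2 < 1"
        by (simp add: abs_square_less_1 abs_less_iff)
      then show False
        using circle[of u] u(2) by simp
    qed
    have "x2 < \<xi> t"
      using \<xi>_incr[OF \<open>t > 0\<close>] Re_pos \<xi>0 by simp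
    then have "B x2 < B (\<xi> t)"
      using B_less x2 \<xi>_less[of t] \<open>t > 0\<close> by simp
    then have "Im (v 0) < Im (v t)"
      using energy[of t] v0(1) by (simp add: S_def)
    then show False
      using \<open>v t = v 0\<close> by simp
  qed
  then show ?thesis
    by (simp add: \<beta>)
qed

section \<open>Fourier analysis of the displacement\<close>

lemma integral_periodic_shift:
  fixes f :: "real \<Rightarrow> real"
  assumes "continuous_on UNIV f" "\<And>x. f (x + p) = f x" "p > 0"
  shows "integral {0..p} (\<lambda>x. f (x + s)) = integral {0..p} f"
proof -
  obtain F where F: "\<And>x. (F has_real_derivative f x) (at x)"
    using real_primitive[OF assms(1)] by blast
  have "((\<lambda>x. f (x + s)) has_integral F (p + s) - F (0 + s)) {0..p}"
  proof (rule has_integral_of_primitive)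
    show "((\<lambda>x. F (x + s)) has_real_derivative f (x + s)) (at x)" for x
      using F[of "x + s"] by (simp add: DERIV_shift)
  qed (use assms(3) in simp)
  moreover have "(f has_integral F p - F 0) {0..p}"
    using assms(3) by (intro has_integral_of_primitive F) simp
  ultimately show ?thesis
    using primitive_of_periodic[OF F assms(2), of s] by (simp add: integral_unique add.commute)
qed

lemma integral_periodic_shift_complex:
  fixes f :: "real \<Rightarrow> complex"
  assumes "continuous_on UNIV f" "\<And>x. f (x + p) = f x" "p > 0"
  shows "integral {0..p} (\<lambda>x. f (x + s)) = integral {0..p} f"
proof -
  have int: "f integrable_on {0..p}" "(\<lambda>x. f (x + s)) integrable_on {0..p}"
    by (intro integrable_continuous_real continuous_on_compose2[OF assms(1)] continuous_intros; simp)+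
  have "integral {0..p} (\<lambda>x. Re (f (x + s))) = integral {0..p} (\<lambda>x. Re (f x))"
    "integral {0..p} (\<lambda>x. Im (f (x + s))) = integral {0..p} (\<lambda>x. Im (f x))"
    using assms by (auto intro!: integral_periodic_shift[of "\<lambda>x. Re (f x)"]
        integral_periodic_shift[of "\<lambda>x. Im (f x)"] continuous_intros)
  then show ?thesis
    using integral_linear[OF int(1) bounded_linear_Re] integral_linear[OF int(2) bounded_linear_Re]
      integral_linear[OF int(1) bounded_linear_Im] integral_linear[OF int(2) bounded_linear_Im]
    by (simp add: complex_eq_iff o_def)
qed

text \<open>The cosine part changes sign under x + pi and integrates to 0; the sine part is Bessel's
  integral.\<close>

lemma bessel_J1_integral_cis:
  "((\<lambda>x. of_real (sin x) * cis (- (k * sin x))) has_integral - \<i> * of_real (2 * pi * bessel_J 1 k)) {0..2 * pi}"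
proof -
  define p where "p x = sin x * cos (k * sin x)" for x :: real
  have cont: "continuous_on S p" for S
    unfolding p_def by (intro continuous_intros)
  have "integral {0..2 * pi} (\<lambda>x. p (x + pi)) = integral {0..2 * pi} p"
    by (rule integral_periodic_shift[OF cont]) (auto simp: p_def)
  moreover have "p (x + pi) = - p x" for x
    by (simp add: p_def)
  ultimately have "integral {0..2 * pi} p = 0"
    by simp
  then have "(p has_integral 0) {0..2 * pi}"
    using integrable_continuous_real[OF cont] by (metis integrable_integral)
  from has_integral_diff[OF has_integral_of_real[OF this]
      has_integral_mult_right[OF has_integral_of_real[OF bessel_J1_integral[of k]], of \<i>]]
  have "((\<lambda>x. complex_of_real (p x) - \<i> * of_real (sin x * sin (k * sin x))) has_integral
      - \<i> * of_real (2 * pi * bessel_J 1 k)) {0..2 * pi}"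
    by simp
  moreover have "complex_of_real (p x) - \<i> * of_real (sin x * sin (k * sin x)) =
      of_real (sin x) * cis (- (k * sin x))" for x
    by (simp add: p_def complex_eq_iff)
  ultimately show ?thesis
    by (simp only:)
qed

text \<open>A connected set of reals with two distinct points is uncountable.\<close>

lemma countable_range_continuous_const:
  fixes f :: "real \<Rightarrow> real"
  assumes "continuous_on UNIV f" "countable C" "range f \<subseteq> C"
  shows "f x = f y"
proof (rule ccontr)
  assume "f x \<noteq> f y"
  moreover have "connected (range f)"
    using assms(1) by (intro connected_continuous_image) auto
  ultimately have "uncountable (range f)"
    using connected_uncountable[of "range f" "f x" "f y"] by blast
  then show False
    using assms(2,3) countable_subset by blast
qed

text \<open>
  The condition on \<open>g\<close> says that the vertical displacement after one turn does not depend on the energy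
  \<open>K\<close>. Pairing it with a Fourier mode turns it into the corresponding Fourier coefficient of \<open>g\<close>
  times a value of \<open>J\<^sub>1\<close>.
\<close>
lemma constant_displacement_imp_const:
  fixes g :: "real \<Rightarrow> real"
  assumes "a > 0" "a \<notin> resonant_set" and g: "continuous_on UNIV g" "\<And>u. g (u + a) = g u"
    and int: "(g has_integral 1) {0..a}"
    and disp: "\<And>K. integral {0..2 * pi} (\<lambda>\<phi>. sin \<phi> * g (K + sin \<phi>)) = d"
  shows "g u = 1 / a"
proof -
  define w where "w m = of_int m * (2 * pi / a)" for m :: int
  define c where "c m = integral {0..a} (\<lambda>u. of_real (g u) * cis (w m * u))" for m
  have cont: "continuous_on S (\<lambda>x. f x * cis (r x))"
    if "continuous_on S f" "continuous_on S r" for S and f :: "'x::topological_space \<Rightarrow> complex" and r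
    using that unfolding cis_conv_exp by (intro continuous_intros)
  have gS: "continuous_on S (\<lambda>x. g (r x))" if "continuous_on S r" for S and r :: "'x::topological_space \<Rightarrow> real"
    by (rule continuous_on_compose2[OF g(1) that]) simp
  have wa: "cis (w m * (u + a)) = cis (w m * u)" for m u
  proof -
    have "w m * (u + a) = w m * u + of_int m * (2 * pi)"
      using \<open>a > 0\<close> by (simp add: w_def field_simps)
    moreover have "cis (of_int m * (2 * pi)) = 1"
      using sin_cos_eq_iff[of "of_int m * (2 * pi)" 0] by (simp add: complex_eq_iff mult_ac)
    ultimately show ?thesis
      by (simp only: cis_mult[symmetric] mult_1_right)
  qed
  have exp0: "((\<lambda>u. cis (w m * u)) has_integral 0) {0..a}" if "m \<noteq> 0" for m
  proof -
    have w: "w m \<noteq> 0"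
      using that \<open>a > 0\<close> by (simp add: w_def)
    have "((\<lambda>u. cis (w m * u)) has_integral (- \<i> / w m * cis (w m * a) - (- \<i> / w m * cis (w m * 0)))) {0..a}"
    proof (rule fundamental_theorem_of_calculus)
      show "((\<lambda>u. - \<i> / w m * cis (w m * u)) has_vector_derivative cis (w m * u)) (at u within {0..a})" for u
        using w by (auto simp: has_vector_derivative_complex_iff intro!: derivative_eq_intros)
    qed (use \<open>a > 0\<close> in simp)
    moreover have "cis (w m * a) = cis (w m * 0)"
      using wa[of m 0] by simp
    ultimately show ?thesis
      by simp
  qed
  \<comment> \<open>Translation by s multiplies a Fourier coefficient by a phase; for s = sin \<phi>
    this phase becomes the kernel of Bessel's integral.\<close>
  have shifted: "integral {0..a} (\<lambda>K. of_real (g (K + s)) * cis (w m * K)) = c m * cis (- (w m * s))" for m s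
  proof -
    have "integral {0..a} (\<lambda>K. of_real (g (K + s)) * cis (w m * (K + s))) = c m"
      unfolding c_def using \<open>a > 0\<close> g(2) wa
      by (intro integral_periodic_shift_complex[of "\<lambda>u. of_real (g u) * cis (w m * u)"] cont continuous_intros gS) auto
    then have "integral {0..a} (\<lambda>K. of_real (g (K + s)) * cis (w m * (K + s)) * cis (- (w m * s))) =
        c m * cis (- (w m * s))"
      by simp
    then show ?thesis
      by (simp add: mult.assoc cis_mult ring_distribs)
  qed
  have c_pos: "c m = 0" if "m > 0" for m
  proof -
    let ?f = "\<lambda>K \<phi>. of_real (sin \<phi>) * (complex_of_real (g (K + sin \<phi>)) * cis (w m * K))"
    have fcont: "continuous_on S (\<lambda>\<phi>. sin \<phi> * g (K + sin \<phi>))" for S K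
      by (intro continuous_intros gS)
    have "integral {0..2 * pi} (?f K) = of_real d * cis (w m * K)" for K
    proof -
      have "((\<lambda>\<phi>. sin \<phi> * g (K + sin \<phi>)) has_integral d) {0..2 * pi}"
        using integrable_integral[OF integrable_continuous_real[OF fcont]] disp by metis
      from has_integral_mult_left[OF has_integral_of_real[OF this], of "cis (w m * K)"] show ?thesis
        by (intro integral_unique) (simp add: mult.assoc)
    qed
    \<comment> \<open>A constant in K is orthogonal to every nonzero mode, so the value of
      \<open>d\<close> drops out.\<close>
    then have zero: "integral {0..a} (\<lambda>K. integral {0..2 * pi} (?f K)) = 0"
      using integral_unique[OF exp0[of m]] \<open>m > 0\<close> by simp
    have swap: "integral {0..a} (\<lambda>K. integral {0..2 * pi} (?f K)) =
        integral {0..2 * pi} (\<lambda>\<phi>. integral {0..a} (\<lambda>K. ?f K \<phi>))"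
      using integral_swap_continuous[of 0 0 a "2 * pi" ?f]
      by (simp add: case_prod_unfold cont continuous_intros gS)
    have inner: "integral {0..a} (\<lambda>K. ?f K \<phi>) = c m * (of_real (sin \<phi>) * cis (- (w m * sin \<phi>)))" for \<phi>
      by (simp add: shifted mult.left_commute)
    have outer: "integral {0..2 * pi} (\<lambda>\<phi>. c m * (of_real (sin \<phi>) * cis (- (w m * sin \<phi>)))) =
        c m * (- \<i> * of_real (2 * pi * bessel_J 1 (w m)))"
      by (intro integral_unique has_integral_mult_right bessel_J1_integral_cis)
    have "c m * (- \<i> * of_real (2 * pi * bessel_J 1 (w m))) = 0"
      using zero unfolding swap inner outer .
    moreover have "bessel_J 1 (w m) \<noteq> 0"
    proof
      assume "bessel_J 1 (w m) = 0"
      \<comment> \<open>In \<open>resonant_set\<close> the frequency \<open>w m\<close> takes the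
        place of \<xi>, and m that of n.\<close>
      moreover have "w m > 0" "a = 2 * pi * real (nat m) / w m"
        using \<open>a > 0\<close> \<open>m > 0\<close> by (simp_all add: w_def)
      moreover have "nat m \<ge> 1"
        using \<open>m > 0\<close> by simp
      ultimately have "a \<in> resonant_set"
        unfolding resonant_set_def by blast
      then show False
        using assms(2) by blast
    qed
    ultimately show ?thesis
      by simp
  qed
  \<comment> \<open>Negative frequencies follow by conjugation because \<open>g\<close> is
    real.\<close>
  have c0: "c m = 0" if "m \<noteq> 0" for m
  proof (cases "m > 0")
    case False
    have "c m = cnj (c (- m))"
      unfolding c_def integral_cnj by (simp add: w_def cis_cnj)
    then show ?thesis
      using c_pos[of "- m"] False that by simp
  qed (rule c_pos)
  \<comment> \<open>The displacement says nothing about the mean of \<open>g\<close>; subtracting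
    1/a removes it by \<open>int\<close>.\<close>
  have orth: "orthogonal_to_modes a (\<lambda>u. of_real (g u - 1 / a))"
    unfolding orthogonal_to_modes_def
  proof (intro conjI allI)
    show "continuous_on UNIV (\<lambda>u. complex_of_real (g u - 1 / a))"
      by (intro continuous_intros g)
    fix m :: int
    show "((\<lambda>u. complex_of_real (g u - 1 / a) * cis (of_int m * (2 * pi / a) * u)) has_integral 0) {0..a}"
    proof (cases "m = 0")
      case True
      have "((\<lambda>u. g u - 1 / a) has_integral 1 - 1) {0..a}"
        using has_integral_diff[OF int has_integral_const_real[of "1 / a" 0 a]] \<open>a > 0\<close> by simp
      then have "((\<lambda>u. complex_of_real (g u - 1 / a)) has_integral of_real (1 - 1)) {0..a}"
        by (rule has_integral_of_real)
      then show ?thesis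
        using True by simp
    next
      case False
      have "((\<lambda>u. of_real (g u) * cis (w m * u)) has_integral c m) {0..a}"
        unfolding c_def by (intro integrable_integral integrable_continuous_real cont continuous_intros gS)
      from has_integral_diff[OF this has_integral_mult_right[OF exp0[OF False], of "of_real (1 / a)"]]
      show ?thesis
        using c0[OF False] by (simp add: w_def algebra_simps)
    qed
  qed
  have contg: "continuous_on UNIV (\<lambda>u. g u - 1 / a)"
    by (intro continuous_intros g)
  have "g u - 1 / a = 0"
    by (rule periodic_orthogonal_to_modes_eq_0[OF orth _ \<open>a > 0\<close> contg]) (simp add: g(2))
  then show ?thesis
    by simp
qed

lemma zoll_nonresonant_imp_const:
  assumes "L > 0" "bcon > 0" "bcon \<notin> resonant_set"
    and b: "magnetic_function L b" "depends_only_on_x L b" and avg: "torus_average L b = bcon"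
    and zoll: "zoll L b"
  shows "b (torus_proj L z) = bcon"
proof -
  obtain \<beta> M where \<beta>: "\<And>z. b (torus_proj L z) = \<beta> (Re z)" and cont: "continuous_on UNIV \<beta>"
    and per: "\<And>x. \<beta> (x + 1) = \<beta> x" and "\<And>x y. \<bar>\<beta> x - \<beta> y\<bar> \<le> M * \<bar>x - y\<bar>"
    using magnetic_profile[OF b] by metis
  have pos: "\<beta> x > 0" for x
    using zoll_magnetic_pos[OF assms(1) b zoll, of "of_real x"] avg assms(2) \<beta> by simp
  obtain B where B: "\<And>x. (B has_real_derivative \<beta> x) (at x)"
    using real_primitive[OF cont] by blast
  have "(\<beta> has_integral B 1 - B 0) {0..1}"
    using B by (intro has_integral_of_primitive) simp_all
  then have "B 1 - B 0 = bcon"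
    using torus_average_eq[OF assms(1) \<beta> cont] avg by (simp add: integral_unique)
  then have B1: "B (x + 1) = B x + bcon" for x
    using primitive_of_periodic[OF B per] by simp
  obtain X where XB: "\<And>x. X (B x) = x" and BX: "\<And>u. B (X u) = u"
    and X: "\<And>u. (X has_real_derivative inverse (\<beta> (X u))) (at u)" and Xper: "\<And>u. X (u + bcon) = X u + 1"
    using quasiperiodic_inverse[OF B pos B1 zero_less_one] by metis
  define g where "g u = inverse (\<beta> (X u))" for u
  have gpos: "g u > 0" for u
    by (simp add: g_def pos)
  have contX: "continuous_on UNIV X"
    using X by (meson DERIV_isCont continuous_at_imp_continuous_on)
  have contg: "continuous_on UNIV g"
    unfolding g_def using pos
    by (intro continuous_intros continuous_on_compose2[OF cont contX]) (auto simp: less_imp_neq[symmetric])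
  have X': "(X has_real_derivative g u) (at u)" for u
    using X by (simp add: g_def)
  define \<Delta> where "\<Delta> K = integral {0..2 * pi} (\<lambda>\<phi>. sin \<phi> * g (K + sin \<phi>))" for K
  \<comment> \<open>After m turns a closing orbit has climbed m \<Delta>(K), which must equal L n.
    Both integers may depend on K, but the quotients form a countable set.\<close>
  define C where "C = (\<lambda>(m, n). L * of_int n / of_int m) ` (UNIV :: (int \<times> int) set)"
  have "\<Delta> K \<in> C" for K
  proof -
    have "continuous_on UNIV (\<lambda>\<phi>. sin \<phi> * g (K + sin \<phi>))"
      by (intro continuous_intros continuous_on_compose2[OF contg]) auto
    then obtain Y where Y: "Y 0 = 0" "\<And>\<phi>. (Y has_real_derivative sin \<phi> * g (K + sin \<phi>)) (at \<phi>)"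
      using real_primitive by blast
    have "((\<lambda>\<phi>. sin \<phi> * g (K + sin \<phi>)) has_integral Y (2 * pi) - Y 0) {0..2 * pi}"
      using Y by (intro has_integral_of_primitive) simp_all
    then have "\<Delta> K = Y (2 * pi) - Y 0"
      by (simp add: \<Delta>_def integral_unique)
    moreover have "Y (\<phi> + 2 * pi) = Y \<phi> + (Y (2 * pi) - Y 0)" for \<phi>
      by (rule primitive_of_periodic[OF Y(2)]) simp
    ultimately have Yper: "Y (\<phi> + 2 * pi) = Y \<phi> + \<Delta> K" for \<phi>
      by simp
    have bX: "b (torus_proj L z) = inverse (g u)" if "Re z = X u" for z u
      by (simp add: \<beta> that g_def)
    obtain h where h: "strict_mono h" "surj h" "h 0 = 0"
      "\<And>\<theta>. magnetic_flow L b (h \<theta>) (torus_proj L (Complex (X (K + sin 0)) 0), cis 0) =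
       (torus_proj L (Complex (X (K + sin (0 + \<theta>))) (0 + Y (0 + \<theta>) - Y 0)), cis (0 + \<theta>))"
      using magnetic_flow_explicit[OF b X' gpos contg bX Y(2), of 0 0] by blast
    have "(torus_proj L (Complex (X (K + sin 0)) 0), cis 0) \<in> unit_tangent_bundle L"
      by (simp add: unit_tangent_bundle_def torus_def)
    then obtain t where t: "t > 0" "magnetic_flow L b t (torus_proj L (Complex (X (K + sin 0)) 0), cis 0) =
        (torus_proj L (Complex (X (K + sin 0)) 0), cis 0)"
      using zoll_closed_orbit[OF zoll] by blast
    \<comment> \<open>The closing time corresponds to an angle \<theta>, and equality of the
      velocities makes it a whole number of turns.\<close>
    obtain \<theta> where \<theta>: "h \<theta> = t"
      using h(2) by (metis surjD)
    then have "\<theta> > 0"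
      using t(1) h(1,3) by (metis strict_mono_less)
    have closed: "torus_proj L (Complex (X (K + sin \<theta>)) (Y \<theta>)) = torus_proj L (Complex (X K) 0)" "cis \<theta> = cis 0"
      using h(4)[of \<theta>] t(2) Y(1) by (simp_all add: \<theta>)
    obtain m :: int where m: "\<theta> = of_int m * (2 * pi)"
      using cis_eqE[OF closed(2)] by auto
    then have "m > 0"
      using \<open>\<theta> > 0\<close> by (simp add: zero_less_mult_iff)
    have "Y \<theta> = of_int m * \<Delta> K"
      using quasiperiodic_int[of Y "2 * pi" "\<Delta> K" 0 m] Yper Y(1) m by simp
    moreover obtain n :: int where "Y \<theta> = L * of_int n"
      using closed(1) by (auto simp: torus_proj_eq_iff complex_eq_iff)
    ultimately have "\<Delta> K = (\<lambda>(m, n). L * of_int n / of_int m) (m, n)"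
      using \<open>m > 0\<close> by (simp add: field_simps)
    then show ?thesis
      unfolding C_def by blast
  qed
  moreover have "countable C"
    unfolding C_def by (intro countable_image) simp
  moreover have "continuous_on UNIV \<Delta>"
    unfolding \<Delta>_def
    using integral_continuous_on_param[of UNIV 0 "2 * pi" "\<lambda>K \<phi>. sin \<phi> * g (K + sin \<phi>)"]
    by (simp add: case_prod_unfold continuous_intros continuous_on_compose2[OF contg])
  ultimately have "\<Delta> K = \<Delta> 0" for K
    by (intro countable_range_continuous_const) auto
  moreover have "g (u + bcon) = g u" for u
    using Xper per by (simp add: g_def)
  moreover have "(g has_integral 1) {0..bcon}"
  proof -
    have "(g has_integral X bcon - X 0) {0..bcon}"
      using X' assms(2) by (intro has_integral_of_primitive) simp_all
    then show ?thesis
      using Xper[of 0] by simp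
  qed
  ultimately have "g (B (Re z)) = 1 / bcon"
    using assms(2,3) contg by (intro constant_displacement_imp_const[where d = "\<Delta> 0"]) (auto simp: \<Delta>_def)
  then show ?thesis
    by (simp add: \<beta> g_def XB divide_inverse)
qed

theorem theorem2p1:
  fixes L bcon :: real
  assumes "L > 0" and "bcon > 0"
  shows "(bcon \<in> resonant_set \<longrightarrow>
      (\<exists>b :: real \<Rightarrow> complex set \<Rightarrow> real.
         (\<forall>q\<in>torus L. b 0 q = bcon) \<and>
         (\<forall>s\<in>{- (1 / bcon)<..<1 / bcon}.
            magnetic_function L (b s) \<and> (\<forall>q\<in>torus L. b s q > 0) \<and> depends_only_on_x L (b s) \<and>
            torus_average L (b s) = bcon \<and> zoll L (b s)) \<and>
         (\<exists>b'. (\<forall>q\<in>torus L. ((\<lambda>s. b s q) has_real_derivative b' q) (at 0)) \<and>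
               (\<exists>q\<in>torus L. b' q \<noteq> 0)) \<and>
         filterlim (\<lambda>s. SUP q\<in>torus L. b s q) at_top (at_left (1 / bcon)) \<and>
         filterlim (\<lambda>s. SUP q\<in>torus L. b s q) at_top (at_right (- (1 / bcon))))) \<and>
    (bcon \<notin> resonant_set \<longrightarrow>
      (\<forall>b. magnetic_function L b \<and> depends_only_on_x L b \<and> torus_average L b = bcon \<longrightarrow>
         (zoll L b \<longleftrightarrow> (\<forall>q\<in>torus L. b q = bcon))))"

proof (intro conjI impI allI)
  assume "bcon \<in> resonant_set"
  then show "\<exists>b :: real \<Rightarrow> complex set \<Rightarrow> real.
         (\<forall>q\<in>torus L. b 0 q = bcon) \<and>
         (\<forall>s\<in>{- (1 / bcon)<..<1 / bcon}.
            magnetic_function L (b s) \<and> (\<forall>q\<in>torus L. b s q > 0) \<and> depends_only_on_x L (b s) \<and>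
            torus_average L (b s) = bcon \<and> zoll L (b s)) \<and>
         (\<exists>b'. (\<forall>q\<in>torus L. ((\<lambda>s. b s q) has_real_derivative b' q) (at 0)) \<and>
               (\<exists>q\<in>torus L. b' q \<noteq> 0)) \<and>
         filterlim (\<lambda>s. SUP q\<in>torus L. b s q) at_top (at_left (1 / bcon)) \<and>
         filterlim (\<lambda>s. SUP q\<in>torus L. b s q) at_top (at_right (- (1 / bcon)))"
    by (rule resonant_zoll_family[OF assms])
next
  fix b
  assume nonres: "bcon \<notin> resonant_set"
    and b: "magnetic_function L b \<and> depends_only_on_x L b \<and> torus_average L b = bcon"
  show "zoll L b \<longleftrightarrow> (\<forall>q\<in>torus L. b q = bcon)"
  proof
    assume "zoll L b"
    then show "\<forall>q\<in>torus L. b q = bcon"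
      using zoll_nonresonant_imp_const[OF assms nonres] b by (auto simp: torus_def)
  next
    assume "\<forall>q\<in>torus L. b q = bcon"
    then show "zoll L b"
      using zoll_constant[OF assms(2)] by blast
  qed
qed

end
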